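(* Let $\mathbf{X}=(X_1,\dots,X_m)$ be a random vector with a density function $f(\mathbf{x})$ on a support $\Omega\subset\mathbb{R}^m$, let $g$ and $h$ be real-valued functions with $h$ continuous, and suppose that $h(\mathbf{x})$ is continuously differentiable for almost all $\mathbf{x}\in\Omega$ up to a Lebesgue null set. Let $(c_0,c_1)$ be the interval in which $h(\mathbf{x})$ may take values for $\mathbf{x}\in\Omega$ ($c_0=-\infty$ and $c_1=\infty$ allowed), let $\xi\in(c_0,c_1)$, and set $$\alpha(\xi)=\mathrm{E}\left[g(\mathbf{X})\cdot1_{\{h(\mathbf{X})\le\xi\}}\right],\qquad\alpha'(\xi)=\frac{d}{d\xi}\alpha(\xi).$$ Suppose that $h$ is homogeneous, i.e., $h(t\mathbf{x})=t\,h(\mathbf{x})$ for $t>0$. Then $$\alpha(\xi)=\mathrm{E}\left[\bar w\big(\mathbf{X}/h(\mathbf{X});\xi\big)\right],$$ where $$\bar w(\mathbf{z};\xi)=\left.\int_{c_0}^{\xi}\frac{|h(\mathrm{sign}(t)\mathbf{z})|^{m-1}g(t\mathbf{z})f(t\mathbf{z})}{\bar J_m(\mathbf{z},t)}\,dt\right/\int_{c_0}^{c_1}\frac{|h(\mathrm{sign}(t)\mathbf{z})|^{m-1}f(t\mathbf{z})}{\bar J_m(\mathbf{z},t)}\,dt .$$ If, in addition, $\bar w(\mathbf{X}/h(\mathbf{X});\cdot)$ satisfies a Lipschitz continuity condition with respect to $\xi$, i.e., there exists a random variable $K$ with $\mathrm{E}(K)<\infty$ such that for all small enough $\Delta$,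 $|\bar w(\mathbf{X}/h(\mathbf{X});\xi+\Delta)-\bar w(\mathbf{X}/h(\mathbf{X});\xi)|\le K|\Delta|$ with probability $1$, then $$\alpha'(\xi)=\mathrm{E}\left[\bar\nu(\mathbf{X}/h(\mathbf{X});\xi)\right],$$ where $$\bar\nu(\mathbf{z};\xi)=\left.\frac{|h(\mathrm{sign}(\xi)\mathbf{z})|^{m-1}g(\xi\mathbf{z})f(\xi\mathbf{z})}{\bar J_m(\mathbf{z},\xi)}\right/\int_{c_0}^{c_1}\frac{|h(\mathrm{sign}(t)\mathbf{z})|^{m-1}f(t\mathbf{z})}{\bar J_m(\mathbf{z},t)}\,dt .$$
   Context: $\partial_i h$ denotes the partial derivative of $h$ with respect to $x_i$; $\mathrm{sign}(t)=1$ if $t>0$ and $-1$ if $t<0$; and $$\bar J_m(\mathbf{z},t)=\frac{1}{|t|^{m-1}}\sqrt{(\partial_1h(t\mathbf{z}))^2+\dots+(\partial_mh(t\mathbf{z}))^2}.$$ The set $\{\mathbf{x}\in\Omega:h(\mathbf{x})=0\}$ is discarded: the paper works with $\Omega'=\Omega\setminus\{\mathbf{x}\in\Omega:h(\mathbf{x})=0\}$, and $\Pr(h(\mathbf{X})=0)=0$. Let $\bar u(\mathbf{x})=(x_1/h(\mathbf{x}),\dots,x_m/h(\mathbf{x}),h(\mathbf{x}))$ for $\mathbf{x}\in\Omega'$. The integrands (and the numerator of $\bar\nu$) are taken to be $0$ at those $(\mathbf{z},t)$ that do not belong to the image $\bar u\{\Omega'\}$, i.e., unless $t\neq0$, $t\mathbf{z}\in\Omega$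 and $h(t\mathbf{z})=t$. It is assumed that the expectation defining $\alpha$ exists. No smoothness is required of $g$, which may be discontinuous.
   Formalization: The formula for α'(ξ) fails at some ξ as stated (m=1, h(x)=x, X normal, g=1 only at ξ≠0); it is proved if, almost surely, the numerator integrand of w̄ along the ray of X/h(X) is continuous at t=ξ, and without that condition for almost every ξ. *)

theory Defs
  imports "HOL-Probability.Probability"
begin

definition partial_deriv :: "(real^'m \<Rightarrow> real) \<Rightarrow> 'm \<Rightarrow> real^'m \<Rightarrow> real" where
  "partial_deriv h i x = deriv (\<lambda>s. h (x + s *\<^sub>R axis i 1)) 0"

(* No differentiability is asked for on the exceptional null set N, which may be dense in \<Omega>:
   continuity of the gradient is relative to \<Omega> - N.  This is implied by h being C^1 in a
   neighbourhood of almost every point of \<Omega>. *)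
definition continuously_differentiable_ae_on :: "(real^'m) set \<Rightarrow> (real^'m \<Rightarrow> real) \<Rightarrow> bool" where
  "continuously_differentiable_ae_on \<Omega> h \<longleftrightarrow>
     (\<exists>N \<in> null_sets lebesgue.
        (\<forall>x \<in> \<Omega> - N. h differentiable (at x)) \<and>
        (\<forall>i. continuous_on (\<Omega> - N) (partial_deriv h i)))"

definition pos_homogeneous :: "(real^'m \<Rightarrow> real) \<Rightarrow> bool" where
  "pos_homogeneous h \<longleftrightarrow> (\<forall>x. \<forall>t>0. h (t *\<^sub>R x) = t * h x)"

definition ubar :: "(real^'m \<Rightarrow> real) \<Rightarrow> real^'m \<Rightarrow> (real^'m) \<times> real" where
  "ubar h x = (x /\<^sub>R h x, h x)"

definition Jbar :: "(real^'m \<Rightarrow> real) \<Rightarrow> real^'m \<Rightarrow> real \<Rightarrow> real" where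
  "Jbar h z t =
     1 / \<bar>t\<bar> ^ (CARD('m) - 1) * sqrt (\<Sum>i\<in>UNIV. (partial_deriv h i (t *\<^sub>R z))\<^sup>2)"

(* The common shape of all integrands; \<phi> is either f or g * f. *)
definition ray_integrand ::
  "(real^'m) set \<Rightarrow> (real^'m \<Rightarrow> real) \<Rightarrow> (real^'m \<Rightarrow> real) \<Rightarrow> real^'m \<Rightarrow> real \<Rightarrow> real" where
  "ray_integrand \<Omega> h \<phi> z t =
     (if (z, t) \<in> ubar h ` (\<Omega> - {x \<in> \<Omega>. h x = 0})
      then \<bar>h (sgn t *\<^sub>R z)\<bar> ^ (CARD('m) - 1) * \<phi> (t *\<^sub>R z) / Jbar h z t
      else 0)"

definition wbar ::
  "(real^'m) set \<Rightarrow> (real^'m \<Rightarrow> real) \<Rightarrow> (real^'m \<Rightarrow> real) \<Rightarrow> (real^'m \<Rightarrow> real) \<Rightarrow>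
   ereal \<Rightarrow> ereal \<Rightarrow> real^'m \<Rightarrow> real \<Rightarrow> real" where
  "wbar \<Omega> f g h c0 c1 z \<xi> =
     (LBINT t=c0..ereal \<xi>. ray_integrand \<Omega> h (\<lambda>x. g x * f x) z t) /
     (LBINT t=c0..c1. ray_integrand \<Omega> h f z t)"

definition nubar ::
  "(real^'m) set \<Rightarrow> (real^'m \<Rightarrow> real) \<Rightarrow> (real^'m \<Rightarrow> real) \<Rightarrow> (real^'m \<Rightarrow> real) \<Rightarrow>
   ereal \<Rightarrow> ereal \<Rightarrow> real^'m \<Rightarrow> real \<Rightarrow> real" where
  "nubar \<Omega> f g h c0 c1 z \<xi> =
     ray_integrand \<Omega> h (\<lambda>x. g x * f x) z \<xi> /
     (LBINT t=c0..c1. ray_integrand \<Omega> h f z t)"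

definition alpha ::
  "'a measure \<Rightarrow> ('a \<Rightarrow> real^'m) \<Rightarrow> (real^'m \<Rightarrow> real) \<Rightarrow> (real^'m \<Rightarrow> real) \<Rightarrow> real \<Rightarrow> real" where
  "alpha M X g h \<xi> = (LINT \<omega>|M. g (X \<omega>) * indicat_real {..\<xi>} (h (X \<omega>)))"

(* The null event may depend on \<Delta>; a bound that holds almost surely for all small \<Delta> at once
   implies this one. *)
definition stochastic_lipschitz_at :: "'a measure \<Rightarrow> ('a \<Rightarrow> real \<Rightarrow> real) \<Rightarrow> real \<Rightarrow> bool" where
  "stochastic_lipschitz_at M W \<xi> \<longleftrightarrow>
     (\<exists>K. integrable M K \<and>
        (\<forall>\<^sub>F \<Delta> in at 0. AE \<omega> in M. \<bar>W \<omega> (\<xi> + \<Delta>) - W \<omega> \<xi>\<bar> \<le> K \<omega> * \<bar>\<Delta>\<bar>))"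

(* The expectation is taken over the completion of M, where it agrees with the one over M
   whenever Y is M-measurable: partial derivatives of h on the exceptional Lebesgue null set are
   arbitrary, so wbar and nubar are only almost surely equal to Borel functions of z. *)
definition has_expectation :: "'a measure \<Rightarrow> ('a \<Rightarrow> real) \<Rightarrow> real \<Rightarrow> bool" where
  "has_expectation M Y e \<longleftrightarrow>
     integrable (completion M) Y \<and> (LINT \<omega>|completion M. Y \<omega>) = e"

end

theory Submission
  imports Defs
begin

text \<open>
  For \<open>h x \<noteq> 0\<close> put \<open>z = x / h x\<close>. All points \<open>t z\<close> with \<open>h (t z) = t\<close> share the same \<open>z\<close>, and
  integrating a kernel \<open>k (x, t z)\<close> with weight \<open>|t| ^ (m - 1)\<close> over such \<open>t\<close> and then over \<open>x\<close> is
  symmetric in the two arguments of \<open>k\<close>. Hence \<open>t \<mapsto> |t| ^ (m - 1) f (t z)\<close>, normalised over the ray, is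
  the conditional density of \<open>h X\<close> given \<open>X / h X = z\<close>, and no surface measure is needed. The gradient
  norm in \<open>wbar\<close> and \<open>nubar\<close> is constant along the ray, even across \<open>t = 0\<close>: almost everywhere
  on the set where \<open>h (- x) = - h x\<close> the gradients at \<open>x\<close> and \<open>- x\<close> agree. So it cancels from both quotients.
  By Fubini \<open>\<alpha>\<close> is the indefinite integral of the expectation of \<open>nubar\<close>, which gives its
  derivative at almost every \<open>\<xi>\<close>; at a continuity point the Lipschitz bound allows dominated convergence.
\<close>

section \<open>Differentiation of integrals on the line\<close>

text \<open>Regularity of \<open>h\<close> is assumed only on \<open>\<Omega>\<close>, and the
  exceptional null set may be dense there, so neither \<open>h\<close> nor its partial derivatives
  can be taken to be Borel. Homogeneity repairs this: differentiability at one point spreads over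
  its half-ray, so \<open>h\<close> can be cut off to a Borel cone of points of differentiability.
  The cut function is Borel and homogeneous, and it agrees with \<open>h\<close> at almost every
  point where \<open>f\<close> does not vanish. The derivative comes in two forms because
  \<open>nubar\<close> at a single \<xi> reads \<open>f\<close> and \<open>g\<close> on the level
  set where \<open>h\<close> equals \<xi>. For \<xi> \<noteq> 0 this set meets each half-ray at most
  once, so its part in the cone is null, and changing \<open>f\<close> or \<open>g\<close> there
  leaves \<alpha> as it is. A formula at a prescribed \<xi> must therefore tie the value at \<xi> to
  neighbouring ones, which continuity of the integrand along the ray does; without it the formula
  can be claimed only for almost every \<xi>.\<close>

text \<open>By outer regularity \<open>{e < p}\<close> has an open neighbourhood \<open>G\<close> on which the excess of \<open>e\<close> over \<open>p\<close> has small
  integral, whereas Vitali covers the bad points by disjoint intervals inside \<open>G\<close> with average at least \<open>q\<close>.\<close>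
lemma AE_interval_average_le:
  fixes e :: "real \<Rightarrow> real"
  assumes e: "integrable lborel e" and pq: "p < q"
  shows "AE x in lborel. e x < p \<longrightarrow>
    (\<exists>d>0. \<forall>c r. 0 < r \<and> r < d \<and> x \<in> cball c r \<longrightarrow> (LINT t:cball c r|lborel. e t) < q * (2 * r))"
proof -
  let ?bad = "\<lambda>x. e x < p \<and> (\<forall>d>0. \<exists>c r. 0 < r \<and> r < d \<and> x \<in> cball c r \<and> q * (2 * r) \<le> (LINT t:cball c r|lborel. e t))"
  have [measurable]: "e \<in> borel_measurable borel" using e by auto
  have neg: "negligible ({x. ?bad x} \<inter> ball 0 n)" (is "negligible ?E") for n :: real
  proof -
    \<comment> \<open>The excess is cut to a ball because for negative \<open>p\<close> it has
      infinite mass on the line, while outer regularity is applied to a finite measure.\<close>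
    define \<nu> where "\<nu> = density lborel (\<lambda>x. ennreal (max 0 (e x - p)) * indicator (ball 0 n) x)"
    have m\<nu>: "(\<lambda>x. ennreal (max 0 (e x - p)) * indicator (ball 0 n) x) \<in> borel_measurable lborel"
      by (intro borel_measurable_times_ennreal borel_measurable_indicator) auto
    have [simp]: "sets \<nu> = sets borel" by (simp add: \<nu>_def)
    have fin: "emeasure \<nu> (space \<nu>) < top"
    proof -
      have "emeasure \<nu> (space \<nu>) = (\<integral>\<^sup>+x. ennreal (max 0 (e x - p)) * indicator (ball 0 n) x \<partial>lborel)"
        unfolding \<nu>_def by (simp add: emeasure_density[OF m\<nu>] del: ennreal_max_0)
      also have "\<dots> \<le> (\<integral>\<^sup>+x. ennreal \<bar>e x\<bar> + ennreal \<bar>p\<bar> * indicator (ball 0 n) x \<partial>lborel)"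
        by (intro nn_integral_mono) (auto split: split_indicator simp: ennreal_plus[symmetric] simp del: ennreal_plus intro!: ennreal_leI)
      also have "\<dots> = (\<integral>\<^sup>+x. ennreal \<bar>e x\<bar> \<partial>lborel) + ennreal \<bar>p\<bar> * emeasure lborel (ball (0::real) n)"
        by (subst nn_integral_add) (auto simp: nn_integral_cmult_indicator intro!: borel_measurable_times_ennreal borel_measurable_indicator)
      finally have *: "emeasure \<nu> (space \<nu>) \<le> (\<integral>\<^sup>+x. ennreal \<bar>e x\<bar> \<partial>lborel) + ennreal \<bar>p\<bar> * emeasure lborel (ball (0::real) n)" .
      have "(\<integral>\<^sup>+x. ennreal \<bar>e x\<bar> \<partial>lborel) + ennreal \<bar>p\<bar> * emeasure lborel (ball (0::real) n) < top"
        using e emeasure_bounded_finite[of "ball (0::real) n"] by (simp add: integrable_iff_bounded ennreal_mult_less_top)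
      with * show ?thesis by (rule le_less_trans)
    qed
    have "emeasure \<nu> {x. e x < p} = 0"
    proof -
      have "(\<integral>\<^sup>+x. ennreal (max 0 (e x - p)) * indicator (ball 0 n) x * indicator {x. e x < p} x \<partial>lborel) = (\<integral>\<^sup>+x. 0 \<partial>(lborel::real measure))"
        by (intro nn_integral_cong) (auto split: split_indicator simp: max_def)
      then show ?thesis
        unfolding \<nu>_def by (simp add: emeasure_density[OF m\<nu>] del: ennreal_max_0)
    qed
    then have inf0: "(INF U\<in>{U. {x. e x < p} \<subseteq> U \<and> open U}. emeasure \<nu> U) = 0"
      using outer_regular[of \<nu> "{x. e x < p}"] fin by simp
    show ?thesis
      unfolding negligible_outer_le
    proof (intro allI impI)
      fix \<epsilon> :: real assume \<epsilon>: "0 < \<epsilon>"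
      \<comment> \<open>A ball with average at least \<open>q\<close> has excess at least
        \<open>q - p\<close> times its length, so excess below \<open>\<epsilon> * (q - p)\<close>
        on \<open>G\<close> bounds the total length of disjoint such balls by
        \<open>\<epsilon>\<close>.\<close>
      have "0 < ennreal (\<epsilon> * (q - p))" using \<epsilon> pq by simp
      then have "(INF U\<in>{U. {x. e x < p} \<subseteq> U \<and> open U}. emeasure \<nu> U) < ennreal (\<epsilon> * (q - p))"
        using inf0 by simp
      then obtain G where G: "{x. e x < p} \<subseteq> G" "open G" and G\<epsilon>: "emeasure \<nu> G < ennreal (\<epsilon> * (q - p))"
        unfolding INF_less_iff by blast
      let ?G = "G \<inter> ball 0 n"
      let ?K = "{(c, r). 0 < r \<and> cball c r \<subseteq> ?G \<and> q * (2 * r) \<le> (LINT t:cball c r|lborel. e t)}"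
      have cover: "\<exists>i. i \<in> ?K \<and> x \<in> cball (fst i) (snd i) \<and> snd i < d" if "x \<in> ?E" "0 < d" for x d
      proof -
        have "x \<in> ?G" "open ?G" using that G by auto
        then obtain s where s: "0 < s" "ball x s \<subseteq> ?G" by (meson openE)
        \<comment> \<open>A bad ball contains \<open>x\<close> but need not be centred there; a
          radius below \<open>s/2\<close> makes its diameter less than \<open>s\<close>, which keeps
          it inside \<open>ball x s\<close>.\<close>
        moreover have "?bad x" "0 < min d (s/2)" using that s by auto
        ultimately obtain c r where r: "0 < r" "r < min d (s/2)" "x \<in> cball c r" "q * (2 * r) \<le> (LINT t:cball c r|lborel. e t)"
          by blast
        have "cball c r \<subseteq> ball x s"
          using r by (auto simp: dist_real_def)
        then show ?thesis using r s by (intro exI[of _ "(c, r)"]) auto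
      qed
      obtain C where C: "countable C" "C \<subseteq> ?K"
        "pairwise (\<lambda>i j. disjnt (cball (fst i) (snd i)) (cball (fst j) (snd j))) C"
        "negligible (?E - (\<Union>i\<in>C. cball (fst i) (snd i)))"
      proof (rule Vitali_covering_theorem_cballs[of ?K snd ?E fst])
        show "0 < snd i" if "i \<in> ?K" for i using that by auto
        show "\<exists>i. i \<in> ?K \<and> x \<in> cball (fst i) (snd i) \<and> snd i < d" if "x \<in> ?E" "0 < d" for x d
          using that by (rule cover)
      qed (rule that, assumption+)
      let ?U = "\<Union>i\<in>C. cball (fst i) (snd i)"
      have disj: "disjoint_family_on (\<lambda>i. cball (fst i) (snd i)) C"
        using C(3) by (auto simp: disjoint_family_on_def pairwise_def disjnt_def)
      have ball_le: "ennreal (q - p) * emeasure lborel (cball c r) \<le> emeasure \<nu> (cball c r)" if "(c, r) \<in> ?K" for c r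
      proof -
        have r: "0 < r" "cball c r \<subseteq> ?G" "q * (2 * r) \<le> (LINT t:cball c r|lborel. e t)" using that by auto
        have ie: "set_integrable lborel (cball c r) e"
          unfolding set_integrable_def by (rule integrable_mult_indicator[OF _ e]) simp
        have ip: "set_integrable lborel (cball c r) (\<lambda>x. p)"
          using integrable_real_indicator[of "cball c r" lborel] r(1)
          by (simp add: set_integrable_def cball_eq_atLeastAtMost)
        have len: "measure lborel (cball c r) = 2 * r"
          using r by (simp add: cball_eq_atLeastAtMost)
        have "(q - p) * (2 * r) \<le> (LINT t:cball c r|lborel. e t) - (LINT t:cball c r|lborel. p)"
          using r(3) len by (simp add: algebra_simps set_lebesgue_integral_def[of _ _ "\<lambda>t. p"])
        also have "\<dots> = (LINT t:cball c r|lborel. e t - p)"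
          using ie ip by simp
        finally have "ennreal ((q - p) * (2 * r)) \<le> ennreal (LINT t:cball c r|lborel. e t - p)"
          by (rule ennreal_leI)
        also have "\<dots> \<le> (\<integral>\<^sup>+t. ennreal (indicator (cball c r) t *\<^sub>R (e t - p)) \<partial>lborel)"
        proof -
          have i: "integrable lborel (\<lambda>t. indicator (cball c r) t *\<^sub>R (e t - p))"
            using set_integral_diff(1)[OF ie ip] by (simp add: set_integrable_def)
          have "(LINT t:cball c r|lborel. e t - p) \<le> (LINT t|lborel. max 0 (indicator (cball c r) t *\<^sub>R (e t - p)))"
            unfolding set_lebesgue_integral_def using i by (intro integral_mono) auto
          then have "ennreal (LINT t:cball c r|lborel. e t - p)
              \<le> ennreal (LINT t|lborel. max 0 (indicator (cball c r) t *\<^sub>R (e t - p)))"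
            by (rule ennreal_leI)
          also have "\<dots> = (\<integral>\<^sup>+t. ennreal (max 0 (indicator (cball c r) t *\<^sub>R (e t - p))) \<partial>lborel)"
            using i by (intro nn_integral_eq_integral[symmetric]) auto
          finally show ?thesis by simp
        qed
        also have "\<dots> \<le> emeasure \<nu> (cball c r)"
          using r(2) unfolding \<nu>_def
          by (subst emeasure_density[OF m\<nu>]) (simp, intro nn_integral_mono, auto split: split_indicator)
        finally show ?thesis
          using r pq by (simp add: cball_eq_atLeastAtMost ennreal_mult)
      qed
      have "ennreal (q - p) * emeasure lborel ?U = (\<integral>\<^sup>+i. ennreal (q - p) * emeasure lborel (cball (fst i) (snd i)) \<partial>count_space C)"
        using C(1) disj by (subst emeasure_UN_countable) (auto simp: nn_integral_cmult)
      also have "\<dots> \<le> (\<integral>\<^sup>+i. emeasure \<nu> (cball (fst i) (snd i)) \<partial>count_space C)"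
        using ball_le C(2) by (intro nn_integral_mono) auto
      also have "\<dots> = emeasure \<nu> ?U"
        using C(1) disj by (subst emeasure_UN_countable) auto
      also have "\<dots> \<le> emeasure \<nu> G"
      proof (intro emeasure_mono UN_least)
        fix i assume "i \<in> C"
        with C(2) have "i \<in> ?K" by blast
        then show "cball (fst i) (snd i) \<subseteq> G" by (simp add: case_prod_beta)
      qed (simp add: G(2))
      also note G\<epsilon>
      finally have *: "ennreal (q - p) * emeasure lborel ?U < ennreal (\<epsilon> * (q - p))" .
      then have U\<epsilon>: "emeasure lborel ?U < ennreal \<epsilon>"
      proof -
        have "\<not> ennreal \<epsilon> \<le> emeasure lborel ?U"
        proof
          assume "ennreal \<epsilon> \<le> emeasure lborel ?U"
          then have "ennreal (q - p) * ennreal \<epsilon> \<le> ennreal (q - p) * emeasure lborel ?U"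
            by (rule mult_left_mono) simp
          with * show False
            using pq \<epsilon> by (simp add: ennreal_mult[symmetric] mult.commute not_less[symmetric])
        qed
        then show ?thesis by simp
      qed
      have Ub: "?U \<in> sets borel" using C(1) by auto
      then have Ul: "?U \<in> lmeasurable" "measure lebesgue ?U \<le> \<epsilon>"
        using U\<epsilon> \<epsilon>
        by (auto simp: fmeasurable_def measure_def order.strict_trans[OF _ ennreal_less_top]
            intro!: enn2real_leI)
      show "\<exists>T. ?E \<subseteq> T \<and> T \<in> lmeasurable \<and> measure lebesgue T \<le> \<epsilon>"
      proof (intro exI conjI)
        show "?E \<subseteq> ?U \<union> (?E - ?U)" by auto
        show "?U \<union> (?E - ?U) \<in> lmeasurable"
          by (intro fmeasurable.Un Ul negligible_imp_measurable C(4))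
        show "measure lebesgue (?U \<union> (?E - ?U)) \<le> \<epsilon>"
          using Ul measure_Un_null_set[OF fmeasurableD[OF Ul(1)], of "?E - ?U"] C(4)
          by (simp add: negligible_iff_null_sets)
      qed
    qed
  qed
  have "negligible (\<Union>n::nat. {x. ?bad x} \<inter> ball 0 (real n))"
    by (rule negligible_countable_Union) (use neg in \<open>auto simp del: mem_cball\<close>)
  moreover have "(\<Union>n::nat. {x. ?bad x} \<inter> ball 0 (real n)) = {x. ?bad x}"
    using reals_Archimedean2 by auto
  ultimately have "{x. ?bad x} \<in> null_sets lebesgue"
    by (simp add: negligible_iff_null_sets)
  from AE_not_in[OF this] have "AE x in lborel. \<not> ?bad x"
    by (simp add: AE_completion_iff)
  then show ?thesis
  proof eventually_elim
    case (elim x)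
    then show ?case unfolding not_le[symmetric] by blast
  qed
qed

text \<open>The balls only have to contain \<open>x\<close>: the increment of the primitive between
  \<open>x\<close> and \<open>y\<close> is the integral over the interval with these endpoints,
  which is a ball around their midpoint.\<close>

lemma DERIV_integral_of_averages:
  fixes e :: "real \<Rightarrow> real"
  assumes e: "integrable lborel e"
    and avg: "\<And>\<epsilon>. 0 < \<epsilon> \<Longrightarrow> \<exists>d>0. \<forall>c r. 0 < r \<and> r < d \<and> x \<in> cball c r \<longrightarrow>
      \<bar>(LINT t:cball c r|lborel. e t) - e x * (2 * r)\<bar> < \<epsilon> * (2 * r)"
  shows "((\<lambda>u. LINT t:{..u}|lborel. e t) has_real_derivative e x) (at x)"
proof -
  have [measurable]: "e \<in> borel_measurable borel" using e by auto
  have ie: "set_integrable lborel A e" if "A \<in> sets lborel" for A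
    unfolding set_integrable_def by (rule integrable_mult_indicator[OF that e])
  let ?F = "\<lambda>u. LINT t:{..u}|lborel. e t"
  have diff: "?F v - ?F u = (LINT t:cball ((u+v)/2) ((v-u)/2)|lborel. e t)" if "u < v" for u v
  proof -
    have "?F v = ?F u + (LINT t:{u<..v}|lborel. e t)"
      using that by (subst set_integral_Un[symmetric]) (auto intro!: ie arg_cong[where f="\<lambda>A. set_lebesgue_integral lborel A e"])
    moreover have "(LINT t:{u<..v}|lborel. e t) = (LINT t:cball ((u+v)/2) ((v-u)/2)|lborel. e t)"
      unfolding set_lebesgue_integral_def
    proof (rule integral_cong_AE)
      have "AE t in lborel. t \<noteq> u" by (rule AE_lborel_singleton)
      then show "AE t in lborel. indicat_real {u<..v} t *\<^sub>R e t = indicat_real (cball ((u+v)/2) ((v-u)/2)) t *\<^sub>R e t"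
        by eventually_elim (auto simp: cball_eq_atLeastAtMost field_simps split: split_indicator)
    qed (rule borel_measurable_integrable, rule integrable_mult_indicator[OF _ e], simp)+
    ultimately show ?thesis by simp
  qed
  show ?thesis
    unfolding has_field_derivative_iff LIM_def
  proof (intro allI impI)
    fix \<epsilon> :: real assume "0 < \<epsilon>"
    from avg[OF this] obtain d where "d > 0" and d:
      "\<And>c r. 0 < r \<Longrightarrow> r < d \<Longrightarrow> x \<in> cball c r \<Longrightarrow> \<bar>(LINT t:cball c r|lborel. e t) - e x * (2 * r)\<bar> < \<epsilon> * (2 * r)"
      by blast
    have d': "\<bar>(?F v - ?F u) - e x * (v - u)\<bar> < \<epsilon> * (v - u)" if uv: "u < v" "v - u < d" "x \<in> {u..v}" for u v
    proof -
      have two: "2 * ((v - u) / 2) = v - u" by simp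
      have "x \<in> cball ((u+v)/2) ((v-u)/2)" using uv by (simp add: cball_eq_atLeastAtMost field_simps)
      from d[OF _ _ this, unfolded two] show ?thesis
        using uv diff[of u v] by simp
    qed
    show "\<exists>s>0. \<forall>y. y \<noteq> x \<and> dist y x < s \<longrightarrow> dist ((?F y - ?F x) / (y - x)) (e x) < \<epsilon>"
    proof (intro exI conjI allI impI)
      show "0 < d" by fact
      fix y assume y: "y \<noteq> x \<and> dist y x < d"
      have "\<bar>(?F y - ?F x) - e x * (y - x)\<bar> < \<epsilon> * \<bar>y - x\<bar>"
        using d'[of x y] d'[of y x] y by (cases "x < y") (auto simp: dist_real_def algebra_simps abs_if split: if_splits)
      moreover have "(?F y - ?F x) / (y - x) - e x = ((?F y - ?F x) - e x * (y - x)) / (y - x)"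
        using y by (simp add: field_simps)
      ultimately show "dist ((?F y - ?F x) / (y - x)) (e x) < \<epsilon>"
        using y by (simp add: dist_real_def abs_divide divide_less_eq)
    qed
  qed
qed

text \<open>The one-sided estimate, taken for all rational \<open>p < q\<close> so that only
  countably many null sets are discarded, bounds the averages from above; the same for
  \<open>- e\<close> bounds them from below.\<close>

theorem lebesgue_differentiation_real:
  fixes e :: "real \<Rightarrow> real"
  assumes e: "integrable lborel e"
  shows "AE x in lborel. ((\<lambda>u. LINT t:{..u}|lborel. e t) has_real_derivative e x) (at x)"
proof -
  have E: "countable {(p, q). p \<in> \<rat> \<and> q \<in> \<rat> \<and> p < (q::real)}"
    by (rule countable_subset[of _ "\<rat> \<times> \<rat>"]) (auto simp: countable_rat)
  have upper: "AE x in lborel. \<forall>q>g x. \<exists>d>0. \<forall>c r. 0 < r \<and> r < d \<and> x \<in> cball c r \<longrightarrow> (LINT t:cball c r|lborel. g t) < q * (2 * r)"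
    if g: "integrable lborel g" for g :: "real \<Rightarrow> real"
  proof -
    have "AE x in lborel. \<forall>(p, q)\<in>{(p, q). p \<in> \<rat> \<and> q \<in> \<rat> \<and> p < q}. g x < p \<longrightarrow>
      (\<exists>d>0. \<forall>c r. 0 < r \<and> r < d \<and> x \<in> cball c r \<longrightarrow> (LINT t:cball c r|lborel. g t) < q * (2 * r))"
      using AE_interval_average_le[OF g] E by (intro AE_ball_countable') auto
    then show ?thesis
    proof eventually_elim
      case (elim x)
      show ?case
      proof (intro allI impI)
        fix q assume "g x < q"
        then obtain q' where q': "q' \<in> \<rat>" "g x < q'" "q' < q" using Rats_dense_in_real by blast
        then obtain p where p: "p \<in> \<rat>" "g x < p" "p < q'" using Rats_dense_in_real by blast
        obtain d where d: "d > 0" "\<And>c r. 0 < r \<Longrightarrow> r < d \<Longrightarrow> x \<in> cball c r \<Longrightarrow> (LINT t:cball c r|lborel. g t) < q' * (2 * r)"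
          using bspec[OF elim, of "(p, q')"] p q' by (simp del: mem_cball) blast
        have "(LINT t:cball c r|lborel. g t) < q * (2 * r)" if "0 < r" "r < d" "x \<in> cball c r" for c r
        proof -
          have "q' * (2 * r) < q * (2 * r)" using q' that by simp
          with d(2)[OF that] show ?thesis by linarith
        qed
        with d(1) show "\<exists>d>0. \<forall>c r. 0 < r \<and> r < d \<and> x \<in> cball c r \<longrightarrow> (LINT t:cball c r|lborel. g t) < q * (2 * r)"
          by blast
      qed
    qed
  qed
  have "integrable lborel (\<lambda>t. - e t)" using e by simp
  from upper[OF e] upper[OF this] show ?thesis
  proof eventually_elim
    case (elim x)
    show ?case
    proof (rule DERIV_integral_of_averages[OF e])
      fix \<epsilon> :: real assume "0 < \<epsilon>"
      then have ex1: "e x < e x + \<epsilon>" and ex2: "- e x < - e x + \<epsilon>" by auto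
      obtain d1 where d1: "d1 > 0" "\<And>c r. 0 < r \<Longrightarrow> r < d1 \<Longrightarrow> x \<in> cball c r \<Longrightarrow> (LINT t:cball c r|lborel. e t) < (e x + \<epsilon>) * (2 * r)"
        using elim(1)[rule_format, OF ex1] by blast
      obtain d2 where d2: "d2 > 0" "\<And>c r. 0 < r \<Longrightarrow> r < d2 \<Longrightarrow> x \<in> cball c r \<Longrightarrow> (LINT t:cball c r|lborel. - e t) < (- e x + \<epsilon>) * (2 * r)"
        using elim(2)[rule_format, OF ex2] by blast
      show "\<exists>d>0. \<forall>c r. 0 < r \<and> r < d \<and> x \<in> cball c r \<longrightarrow>
          \<bar>(LINT t:cball c r|lborel. e t) - e x * (2 * r)\<bar> < \<epsilon> * (2 * r)"
      proof (intro exI conjI allI impI)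
        show "0 < min d1 d2" using d1 d2 by simp
        fix c r assume r: "0 < r \<and> r < min d1 d2 \<and> x \<in> cball c r"
        then have "(LINT t:cball c r|lborel. e t) < (e x + \<epsilon>) * (2 * r)"
          by (intro d1(2)) auto
        moreover have "- (LINT t:cball c r|lborel. e t) < (- e x + \<epsilon>) * (2 * r)"
          using d2(2)[of r c] r by (simp add: set_lebesgue_integral_def)
        ultimately show "\<bar>(LINT t:cball c r|lborel. e t) - e x * (2 * r)\<bar> < \<epsilon> * (2 * r)"
          unfolding abs_less_iff by (simp add: algebra_simps)
      qed
    qed
  qed
qed

text \<open>The value at the single point \<open>x\<close> matters here, so the almost everywhere
  theorem is of no help. Cutting \<open>I\<close> off at \<open>b\<close> makes it integrable on the
  line and changes nothing near \<open>x\<close>.\<close>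

lemma DERIV_integral_isCont:
  fixes I :: "real \<Rightarrow> real"
  assumes I: "set_integrable lborel {..b} I" and "x < b" and cont: "isCont I x"
  shows "((\<lambda>u. LINT t:{..u}|lborel. I t) has_real_derivative I x) (at x)"
proof -
  define e where "e t = indicator {..b} t *\<^sub>R I t" for t
  have e: "integrable lborel e" using I by (simp add: e_def[abs_def] set_integrable_def)
  have ie: "set_integrable lborel A e" if "A \<in> sets lborel" for A
    unfolding set_integrable_def by (rule integrable_mult_indicator[OF that e])
  have ex: "e x = I x" using \<open>x < b\<close> by (simp add: e_def)
  have "((\<lambda>u. LINT t:{..u}|lborel. e t) has_real_derivative e x) (at x)"
  proof (rule DERIV_integral_of_averages[OF e])
    fix \<epsilon> :: real assume \<epsilon>: "0 < \<epsilon>"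
    then obtain s where s: "s > 0" "\<And>t. \<bar>t - x\<bar> < s \<Longrightarrow> \<bar>I t - I x\<bar> < \<epsilon> / 2"
      using cont unfolding continuous_at_eps_delta dist_real_def by (metis half_gt_zero)
    show "\<exists>d>0. \<forall>c r. 0 < r \<and> r < d \<and> x \<in> cball c r \<longrightarrow>
      \<bar>(LINT t:cball c r|lborel. e t) - e x * (2 * r)\<bar> < \<epsilon> * (2 * r)"
    proof (intro exI conjI allI impI)
      \<comment> \<open>All points of a ball of radius \<open>r\<close> through \<open>x\<close> lie
        within \<open>2 * r\<close> of \<open>x\<close>, hence below \<open>b\<close> and where
        \<open>I\<close> differs from \<open>I x\<close> by less than \<open>\<epsilon> / 2\<close>.
        Integration only preserves weak bounds; the spare half of \<open>\<epsilon>\<close> restores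
        strictness.\<close>
      show "0 < min s (b - x) / 2" using s \<open>x < b\<close> by simp
      fix c r assume r: "0 < r \<and> r < min s (b - x) / 2 \<and> x \<in> cball c r"
      have near: "e x - \<epsilon> / 2 \<le> e t" "e t \<le> e x + \<epsilon> / 2" if "t \<in> cball c r" for t
      proof -
        have "\<bar>t - x\<bar> \<le> 2 * r" using that r by (auto simp: dist_real_def)
        then have "\<bar>t - x\<bar> < s" "t \<le> b" using r by auto
        then have "\<bar>e t - e x\<bar> < \<epsilon> / 2" using s(2)[of t] \<open>x < b\<close> by (simp add: e_def)
        then show "e x - \<epsilon> / 2 \<le> e t" "e t \<le> e x + \<epsilon> / 2" by linarith+
      qed
      have const: "set_integrable lborel (cball c r) (\<lambda>t. a)" "(LINT t:cball c r|lborel. a) = a * (2 * r)" for a :: real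
        using r by (auto simp: set_integrable_def set_lebesgue_integral_def cball_eq_atLeastAtMost)
      have i: "set_integrable lborel (cball c r) e" by (rule ie) simp
      have "(LINT t:cball c r|lborel. e t) \<le> (LINT t:cball c r|lborel. e x + \<epsilon> / 2)"
        using near(2) by (intro set_integral_mono i const)
      moreover have "(LINT t:cball c r|lborel. e x - \<epsilon> / 2) \<le> (LINT t:cball c r|lborel. e t)"
        using near(1) by (intro set_integral_mono i const)
      moreover have "\<epsilon> / 2 * (2 * r) < \<epsilon> * (2 * r)" using \<epsilon> r by simp
      ultimately show "\<bar>(LINT t:cball c r|lborel. e t) - e x * (2 * r)\<bar> < \<epsilon> * (2 * r)"
        unfolding const(2) by (simp only: abs_less_iff left_diff_distrib distrib_right) linarith
    qed
  qed
  then have *: "((\<lambda>u. LINT t:{..u}|lborel. e t) has_real_derivative I x) (at x)" by (simp add: ex)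
  show ?thesis
  proof (rule DERIV_cong_ev[THEN iffD1, OF refl _ refl *])
    show "\<forall>\<^sub>F u in nhds x. (LINT t:{..u}|lborel. e t) = (LINT t:{..u}|lborel. I t)"
      using eventually_nhds_in_open[of "{..<b}" x] \<open>x < b\<close>
      by (auto elim!: eventually_mono simp: set_lebesgue_integral_def e_def intro!: Bochner_Integration.integral_cong split: split_indicator)
  qed
qed

section \<open>Disintegration along rays\<close>

text \<open>The substitution rule is for increasing maps on compact intervals. On the negative
  half-line \<open>s \<mapsto> -1/s\<close> is increasing, whereas \<open>1/s\<close> is not, so the
  negative half is first carried to the positive one and then reflected. Compact intervals exhaust
  the half-lines, which avoids the singularity at 0.\<close>

lemma nn_integral_inverse_subst:
  fixes u :: "real \<Rightarrow> ennreal"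
  assumes [measurable]: "u \<in> borel_measurable borel"
  shows "(\<integral>\<^sup>+s. u (1/s) * ennreal (1/\<bar>s\<bar>) \<partial>lborel) = (\<integral>\<^sup>+r. u r * ennreal (1/\<bar>r\<bar>) \<partial>lborel)"
proof -
  have abs_div_sq: "\<bar>x\<bar> / (x * x) = 1 / \<bar>x\<bar>" for x :: real
    by (cases "x = 0") (auto simp: field_simps)
  have pos: "(\<integral>\<^sup>+r. v r * ennreal (1/\<bar>r\<bar>) * indicator {0<..} r \<partial>lborel)
      = (\<integral>\<^sup>+s. v (-1/s) * ennreal (1/\<bar>s\<bar>) * indicator {..<0} s \<partial>lborel)"
    if [measurable]: "v \<in> borel_measurable borel" for v :: "real \<Rightarrow> ennreal"
  proof -
    \<comment> \<open>Starting at 2 makes every \<open>?a n\<close> exceed 1, so that the interval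
      from \<open>1/?a n\<close> to \<open>?a n\<close> is nondegenerate.\<close>
    let ?a = "\<lambda>n::nat. real (Suc (Suc n))"
    have eq: "(\<integral>\<^sup>+r. v r * ennreal (1/\<bar>r\<bar>) * indicator {1/?a n..?a n} r \<partial>lborel)
      = (\<integral>\<^sup>+s. v (-1/s) * ennreal (1/\<bar>s\<bar>) * indicator {-?a n..-1/?a n} s \<partial>lborel)" for n
    proof -
      have "(\<integral>\<^sup>+r. (v r * ennreal (1/\<bar>r\<bar>)) * indicator {(\<lambda>s. -1/s) (-?a n)..(\<lambda>s. -1/s) (-1/?a n)} r \<partial>lborel)
        = (\<integral>\<^sup>+s. (\<lambda>r. v r * ennreal (1/\<bar>r\<bar>)) (-1/s) * ennreal (1/s\<^sup>2) * indicator {-?a n..-1/?a n} s \<partial>lborel)"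
      proof (rule nn_integral_substitution_aux)
        have "1 < ?a n * ?a n" by (intro less_1_mult) auto
        then show "-?a n < -1/?a n" by (simp add: field_simps del: of_nat_Suc)
        have "\<And>x. x \<in> {-?a n..-1/?a n} \<Longrightarrow> x < 0"
          by (smt (verit) atLeastAtMost_iff divide_neg_pos of_nat_0_less_iff zero_less_Suc)
        then show "continuous_on {-?a n..-1/?a n} (\<lambda>s. 1/s\<^sup>2)"
          and "\<And>x. x \<in> {-?a n..-1/?a n} \<Longrightarrow> ((\<lambda>s. -1/s) has_real_derivative 1/x\<^sup>2) (at x)"
          by (fastforce intro!: continuous_intros derivative_eq_intros simp: power2_eq_square)+
      qed auto
      also have "\<dots> = (\<integral>\<^sup>+s. v (-1/s) * ennreal (1/\<bar>s\<bar>) * indicator {-?a n..-1/?a n} s \<partial>lborel)"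
        by (intro nn_integral_cong)
           (auto simp: mult.assoc ennreal_mult[symmetric] abs_mult power2_eq_square abs_div_sq split: split_indicator)
      finally have *: "(\<integral>\<^sup>+r. v r * ennreal (1/\<bar>r\<bar>) * indicator {-1/(-?a n)..-1/(-1/?a n)} r \<partial>lborel)
        = (\<integral>\<^sup>+s. v (-1/s) * ennreal (1/\<bar>s\<bar>) * indicator {-?a n..-1/?a n} s \<partial>lborel)" .
      have "-1/(-?a n) = 1/?a n" "-1/(-1/?a n) = ?a n"
        by (simp_all only: minus_divide_divide divide_minus_right divide_divide_eq_right) simp_all
      with * show ?thesis by (simp only:)
    qed
    have arch: "\<exists>n. 1/?a n \<le> r \<and> r \<le> ?a n" if "r > 0" for r :: real
    proof -
      obtain n :: nat where "max r (1/r) \<le> real n" using real_arch_simple by blast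
      with that show ?thesis
        by (intro exI[of _ n]) (simp add: field_simps)
    qed
    have U: "{0<..} = (\<Union>n. {1/?a n..?a n})"
      using arch by (auto intro: less_le_trans[rotated])
    have V: "{..<0} = (\<Union>n. {-?a n..-1/?a n})"
    proof -
      have "\<exists>n. -?a n \<le> r \<and> r \<le> -1/?a n" if "r < 0" for r :: real
        using arch[of "-r"] that by (metis minus_divide_left minus_le_iff le_minus_iff neg_0_less_iff_less)
      then show ?thesis by (auto intro: le_less_trans)
    qed
    have "(\<integral>\<^sup>+r. w r * indicator {0<..} r \<partial>lborel) = (SUP n. \<integral>\<^sup>+r. w r * indicator {1/?a n..?a n} r \<partial>lborel)"
      if [measurable]: "w \<in> borel_measurable borel" for w :: "real \<Rightarrow> ennreal"
    proof -
      have "incseq (\<lambda>n. {1/?a n..?a n})"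
        by (intro incseq_SucI) (auto simp: field_simps intro: order_trans)
      then show ?thesis
        using SUP_emeasure_incseq[of "\<lambda>n. {1/?a n..?a n}" "density lborel w"]
        unfolding U by (subst (1 2) emeasure_density[symmetric]) (auto simp: image_subset_iff)
    qed
    moreover have "(\<integral>\<^sup>+r. w r * indicator {..<0} r \<partial>lborel) = (SUP n. \<integral>\<^sup>+r. w r * indicator {-?a n..-1/?a n} r \<partial>lborel)"
      if [measurable]: "w \<in> borel_measurable borel" for w :: "real \<Rightarrow> ennreal"
    proof -
      have "incseq (\<lambda>n. {-?a n..-1/?a n})"
        by (intro incseq_SucI) (auto simp: field_simps intro: order_trans)
      then show ?thesis
        using SUP_emeasure_incseq[of "\<lambda>n. {-?a n..-1/?a n}" "density lborel w"]
        unfolding V by (subst (1 2) emeasure_density[symmetric]) (auto simp: image_subset_iff)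
    qed
    ultimately show ?thesis using eq by simp
  qed
  have refl: "(\<integral>\<^sup>+s. w s \<partial>lborel) = (\<integral>\<^sup>+s. w (-s) \<partial>lborel)" if "w \<in> borel_measurable borel" for w :: "real \<Rightarrow> ennreal"
    using nn_integral_real_affine[OF that, of "-1" 0] by simp
  have split: "(\<integral>\<^sup>+s. w s * ennreal (1/\<bar>s\<bar>) \<partial>lborel) = (\<integral>\<^sup>+s. w s * ennreal (1/\<bar>s\<bar>) * indicator {0<..} s \<partial>lborel)
      + (\<integral>\<^sup>+s. w s * ennreal (1/\<bar>s\<bar>) * indicator {..<0} s \<partial>lborel)" if [measurable]: "w \<in> borel_measurable borel" for w :: "real \<Rightarrow> ennreal"
    by (subst nn_integral_add[symmetric]) (auto intro!: nn_integral_cong split: split_indicator)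
  have flip: "(\<integral>\<^sup>+s. w s * ennreal (1/\<bar>s\<bar>) * indicator {..<0} s \<partial>lborel)
     = (\<integral>\<^sup>+s. w (-s) * ennreal (1/\<bar>s\<bar>) * indicator {0<..} s \<partial>lborel)" if [measurable]: "w \<in> borel_measurable borel" for w :: "real \<Rightarrow> ennreal"
    by (subst refl) (auto intro!: nn_integral_cong split: split_indicator)
  have pp: "(\<integral>\<^sup>+r. v (1/r) * ennreal (1/\<bar>r\<bar>) * indicator {0<..} r \<partial>lborel)
     = (\<integral>\<^sup>+r. v r * ennreal (1/\<bar>r\<bar>) * indicator {0<..} r \<partial>lborel)"
    if [measurable]: "v \<in> borel_measurable borel" for v :: "real \<Rightarrow> ennreal"
    using flip[of "\<lambda>s. v (-1/s)"] pos[of v] by simp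
  show ?thesis
    using split[of u] split[of "\<lambda>s. u (1/s)"] flip[of u] flip[of "\<lambda>s. u (1/s)"] pp[of u] pp[of "\<lambda>s. u (-s)"]
    by simp
qed

section \<open>Exchanging the two points of a ray\<close>

lemma nn_integral_lborel_scaleR:
  fixes f :: "'a::euclidean_space \<Rightarrow> ennreal"
  assumes [measurable]: "f \<in> borel_measurable borel" and c: "c \<noteq> 0"
  shows "(\<integral>\<^sup>+x. f x \<partial>lborel) = ennreal (\<bar>c\<bar> ^ DIM('a)) * (\<integral>\<^sup>+x. f (c *\<^sub>R x) \<partial>lborel)"
  by (subst lborel_affine[OF c, of 0])
     (simp add: nn_integral_density nn_integral_distr nn_integral_cmult)

text \<open>Dividing by the signed value lets \<open>t\<close> be the value of \<open>H\<close> at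
  the point itself, so two opposite half-rays share one direction when \<open>H\<close> is odd on
  them.\<close>

definition ray_dir :: "('a::euclidean_space \<Rightarrow> real) \<Rightarrow> 'a \<Rightarrow> 'a" where
  "ray_dir H x = x /\<^sub>R H x"

text \<open>The radial density of polar coordinates, with the value \<open>t\<close> as the radius.
  By homogeneity the equation \<open>H (t *\<^sub>R ray_dir H x) = t\<close> is automatic when
  \<open>t\<close> has the sign of \<open>H x\<close>; for the opposite sign it amounts to
  \<open>H (- x) = - H x\<close>.\<close>

definition ray_weight :: "('a::euclidean_space \<Rightarrow> real) \<Rightarrow> 'a \<Rightarrow> real \<Rightarrow> real" where
  "ray_weight H x t = (if H x \<noteq> 0 \<and> H (t *\<^sub>R ray_dir H x) = t then \<bar>t\<bar> ^ (DIM('a) - 1) else 0)"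

lemma ray_weight_nonneg [simp]: "0 \<le> ray_weight H x t"
  by (simp add: ray_weight_def)

locale homogeneous_borel =
  fixes H :: "'a::euclidean_space \<Rightarrow> real"
  assumes borel_H [measurable]: "H \<in> borel_measurable borel"
    and hom: "0 < t \<Longrightarrow> H (t *\<^sub>R x) = t * H x"
begin

abbreviation "Z \<equiv> ray_dir H"
abbreviation "L \<equiv> ray_weight H"

lemma borel_Z [measurable]: "Z \<in> borel_measurable borel"
  unfolding ray_dir_def by measurable

lemma borel_L [measurable (raw)]:
  assumes [measurable]: "f \<in> borel_measurable M" "g \<in> borel_measurable M"
  shows "(\<lambda>x. L (f x) (g x)) \<in> borel_measurable M"
  unfolding ray_weight_def by measurable

lemma ray_dir_on_ray:
  assumes "H (t *\<^sub>R Z x) = t" "t \<noteq> 0"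
  shows "Z (t *\<^sub>R Z x) = Z x"
  using assms by (simp add: ray_dir_def[of H "t *\<^sub>R Z x"])

text \<open>After substituting \<open>t = s * H x\<close> this is the invariance of the Haar measure \<open>ds / |s|\<close> under \<open>s \<mapsto> 1 / s\<close>.\<close>
lemma ray_integral_swap:
  fixes k :: "'a \<Rightarrow> 'a \<Rightarrow> ennreal"
  assumes [measurable]: "(\<lambda>(x, y). k x y) \<in> borel_measurable (borel \<Otimes>\<^sub>M borel)"
  shows "(\<integral>\<^sup>+x. \<integral>\<^sup>+t. L x t * k x (t *\<^sub>R Z x) \<partial>lborel \<partial>lborel)
       = (\<integral>\<^sup>+y. \<integral>\<^sup>+t. L y t * k (t *\<^sub>R Z y) y \<partial>lborel \<partial>lborel)"
proof -
  let ?d = "DIM('a)"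
  \<comment> \<open>The exponent of \<open>\<bar>H x\<bar>\<close> is the full dimension: one factor
    is the Jacobian of \<open>t = s * H x\<close>, the others come from the weight.\<close>
  define A where "A k x s = (if H x \<noteq> 0 \<and> H (s *\<^sub>R x) = s * H x then ennreal (\<bar>s\<bar> ^ (?d - 1) * \<bar>H x\<bar> ^ ?d) * k x (s *\<^sub>R x) else 0)"
    for k :: "'a \<Rightarrow> 'a \<Rightarrow> ennreal" and x s
  have A_meas [measurable]: "(\<lambda>(x, s). A k x s) \<in> borel_measurable (borel \<Otimes>\<^sub>M borel)"
    if [measurable]: "(\<lambda>(x, y). k x y) \<in> borel_measurable (borel \<Otimes>\<^sub>M borel)" for k
    unfolding A_def by measurable
  obtain n where d: "?d = Suc n" using DIM_positive[where 'a='a] by (cases ?d) auto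
  have k': "(\<lambda>(y, x). k x y) \<in> borel_measurable (borel \<Otimes>\<^sub>M borel)" by measurable
  have to_A: "(\<integral>\<^sup>+t. L x t * k x (t *\<^sub>R Z x) \<partial>lborel) = (\<integral>\<^sup>+s. A k x s \<partial>lborel)"
    if [measurable]: "(\<lambda>(x, y). k x y) \<in> borel_measurable (borel \<Otimes>\<^sub>M borel)" for k :: "'a \<Rightarrow> 'a \<Rightarrow> ennreal" and x
  proof (cases "H x = 0")
    case True then show ?thesis by (simp add: ray_weight_def A_def)
  next
    case False
    have "(\<integral>\<^sup>+t. L x t * k x (t *\<^sub>R Z x) \<partial>lborel) = ennreal \<bar>H x\<bar> * (\<integral>\<^sup>+s. L x (0 + H x * s) * k x ((0 + H x * s) *\<^sub>R Z x) \<partial>lborel)"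
      using False by (intro nn_integral_real_affine) measurable
    also have "\<dots> = (\<integral>\<^sup>+s. ennreal \<bar>H x\<bar> * (L x (0 + H x * s) * k x ((0 + H x * s) *\<^sub>R Z x)) \<partial>lborel)"
      by (intro nn_integral_cmult[symmetric]) measurable
    also have "\<dots> = (\<integral>\<^sup>+s. A k x s \<partial>lborel)"
    proof (intro nn_integral_cong)
      fix s :: real
      have "(0 + H x * s) *\<^sub>R Z x = s *\<^sub>R x" using False by (simp add: ray_dir_def)
      moreover have "\<bar>H x\<bar> * \<bar>H x * s\<bar> ^ (?d - 1) = \<bar>s\<bar> ^ (?d - 1) * \<bar>H x\<bar> ^ ?d"
        by (simp add: d abs_mult power_mult_distrib)
      ultimately show "ennreal \<bar>H x\<bar> * (L x (0 + H x * s) * k x ((0 + H x * s) *\<^sub>R Z x)) = A k x s"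
        using False by (simp add: ray_weight_def A_def mult.assoc[symmetric] ennreal_mult[symmetric])
    qed
    finally show ?thesis .
  qed
  \<comment> \<open>\<open>A\<close> seen from the second argument \<open>y = s *\<^sub>R x\<close>
    of the kernel. The power of \<open>s\<close> in \<open>A\<close> and the Jacobian of the scaling
    leave exactly \<open>1 / \<bar>s\<bar>\<close>.\<close>
  define B where "B s y = (if H (inverse s *\<^sub>R y) \<noteq> 0 \<and> H y = s * H (inverse s *\<^sub>R y)
      then ennreal (\<bar>H (inverse s *\<^sub>R y)\<bar> ^ ?d) * k (inverse s *\<^sub>R y) y else 0)" for s y
  have B_meas [measurable]: "(\<lambda>(s, y). B s y) \<in> borel_measurable (borel \<Otimes>\<^sub>M borel)"
    unfolding B_def by measurable
  have scale: "(\<integral>\<^sup>+x. A k x s \<partial>lborel) = (\<integral>\<^sup>+y. B s y * ennreal (1 / \<bar>s\<bar>) \<partial>lborel)" if s: "s \<noteq> 0" for s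
  proof -
    have "(\<integral>\<^sup>+x. A k x s \<partial>lborel) = ennreal (\<bar>inverse s\<bar> ^ ?d) * (\<integral>\<^sup>+y. A k (inverse s *\<^sub>R y) s \<partial>lborel)"
      using s by (intro nn_integral_lborel_scaleR) auto
    also have "\<dots> = (\<integral>\<^sup>+y. ennreal (\<bar>inverse s\<bar> ^ ?d) * A k (inverse s *\<^sub>R y) s \<partial>lborel)"
      by (intro nn_integral_cmult[symmetric]) measurable
    also have "\<dots> = (\<integral>\<^sup>+y. B s y * ennreal (1 / \<bar>s\<bar>) \<partial>lborel)"
    proof (intro nn_integral_cong)
      fix y
      have "\<bar>inverse s\<bar> ^ ?d * \<bar>s\<bar> ^ (?d - 1) = 1 / \<bar>s\<bar>"
        using s by (simp add: d field_simps)
      moreover have div: "ennreal (a / \<bar>s\<bar>) = ennreal (1 / \<bar>s\<bar>) * ennreal a" if "0 \<le> a" for a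
        using that by (simp flip: ennreal_mult)
      ultimately show "ennreal (\<bar>inverse s\<bar> ^ ?d) * A k (inverse s *\<^sub>R y) s = B s y * ennreal (1 / \<bar>s\<bar>)"
        using s unfolding A_def B_def
        by (simp add: mult.assoc[symmetric] ennreal_mult[symmetric] del: abs_inverse) (simp add: div[of "\<bar>H (y /\<^sub>R s)\<bar> ^ DIM('a)"] mult_ac)
    qed
    finally show ?thesis .
  qed
  have "(\<integral>\<^sup>+x. \<integral>\<^sup>+t. L x t * k x (t *\<^sub>R Z x) \<partial>lborel \<partial>lborel) = (\<integral>\<^sup>+x. \<integral>\<^sup>+s. A k x s \<partial>lborel \<partial>lborel)"
    by (simp add: to_A[OF assms])
  also have "\<dots> = (\<integral>\<^sup>+s. \<integral>\<^sup>+x. A k x s \<partial>lborel \<partial>lborel)"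
    by (rule lborel_pair.Fubini'[symmetric]) (use A_meas in simp)
  also have "\<dots> = (\<integral>\<^sup>+s. \<integral>\<^sup>+y. B s y * ennreal (1 / \<bar>s\<bar>) \<partial>lborel \<partial>lborel)"
  proof (rule nn_integral_cong_AE)
    have "AE s in lborel. s \<noteq> (0::real)" by (rule AE_lborel_singleton)
    then show "AE s in lborel. (\<integral>\<^sup>+x. A k x s \<partial>lborel) = (\<integral>\<^sup>+y. B s y * ennreal (1 / \<bar>s\<bar>) \<partial>lborel)"
      by eventually_elim (rule scale)
  qed
  also have "\<dots> = (\<integral>\<^sup>+y. \<integral>\<^sup>+s. B s y * ennreal (1 / \<bar>s\<bar>) \<partial>lborel \<partial>lborel)"
    by (rule lborel_pair.Fubini'[symmetric]) simp
  also have "\<dots> = (\<integral>\<^sup>+y. \<integral>\<^sup>+r. A (\<lambda>y x. k x y) y r \<partial>lborel \<partial>lborel)"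
  proof (rule nn_integral_cong)
    fix y :: 'a
    \<comment> \<open>\<open>B\<close> written in \<open>r = 1 / s\<close>. On the support
      \<open>H (r *\<^sub>R y) = r * H y\<close>, which turns \<open>u r / \<bar>r\<bar>\<close>
      back into \<open>A\<close>, with the arguments of the kernel exchanged.\<close>
    define u where "u r = (if H (r *\<^sub>R y) \<noteq> 0 \<and> H y = inverse r * H (r *\<^sub>R y)
      then ennreal (\<bar>H (r *\<^sub>R y)\<bar> ^ ?d) * k (r *\<^sub>R y) y else 0)" for r
    have [measurable]: "u \<in> borel_measurable borel" unfolding u_def by measurable
    have "(\<integral>\<^sup>+s. B s y * ennreal (1 / \<bar>s\<bar>) \<partial>lborel) = (\<integral>\<^sup>+s. u (1 / s) * ennreal (1 / \<bar>s\<bar>) \<partial>lborel)"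
      by (intro nn_integral_cong) (simp add: B_def u_def divide_inverse)
    also have "\<dots> = (\<integral>\<^sup>+r. u r * ennreal (1 / \<bar>r\<bar>) \<partial>lborel)"
      by (rule nn_integral_inverse_subst) measurable
    also have "\<dots> = (\<integral>\<^sup>+r. A (\<lambda>y x. k x y) y r \<partial>lborel)"
    proof (rule nn_integral_cong_AE)
      have "AE r in lborel. r \<noteq> (0::real)" by (rule AE_lborel_singleton)
      then show "AE r in lborel. u r * ennreal (1 / \<bar>r\<bar>) = A (\<lambda>y x. k x y) y r"
      proof eventually_elim
        case (elim r)
        have eq: "H y = inverse r * H (r *\<^sub>R y) \<longleftrightarrow> H (r *\<^sub>R y) = r * H y"
          using elim by (auto simp: field_simps)
        have pw: "\<bar>r * H y\<bar> ^ ?d * (1 / \<bar>r\<bar>) = \<bar>r\<bar> ^ (?d - 1) * \<bar>H y\<bar> ^ ?d"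
          using elim by (simp add: d abs_mult power_mult_distrib field_simps)
        show ?case
        proof (cases "H (r *\<^sub>R y) = r * H y")
          case True
          then show ?thesis
            using elim pw unfolding u_def A_def eq
            by (simp add: mult.commute mult.assoc[symmetric] ennreal_mult[symmetric])
        qed (simp add: u_def A_def eq)
      qed
    qed
    finally show "(\<integral>\<^sup>+s. B s y * ennreal (1 / \<bar>s\<bar>) \<partial>lborel) = (\<integral>\<^sup>+r. A (\<lambda>y x. k x y) y r \<partial>lborel)" .
  qed
  also have "\<dots> = (\<integral>\<^sup>+y. \<integral>\<^sup>+t. L y t * k (t *\<^sub>R Z y) y \<partial>lborel \<partial>lborel)"
    by (simp add: to_A[OF k'])
  finally show ?thesis .
qed

end

section \<open>Conditional density along a ray\<close>

locale ray_disintegration = homogeneous_borel H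
  for H :: "'a::euclidean_space \<Rightarrow> real" +
  fixes f :: "'a \<Rightarrow> real"
  assumes borel_f [measurable]: "f \<in> borel_measurable borel"
    and f_nonneg: "0 \<le> f x"
    and f_fin: "(\<integral>\<^sup>+x. f x \<partial>lborel) < top"
    and f_supp: "AE x in lborel. f x \<noteq> 0 \<longrightarrow> H x \<noteq> 0"
begin

definition den :: "'a \<Rightarrow> ennreal" where
  "den x = (\<integral>\<^sup>+t. L x t * ennreal (f (t *\<^sub>R Z x)) \<partial>lborel)"

text \<open>Where \<open>den x\<close> is zero or infinite, \<open>enn2real\<close> and division
  make this 0; such \<open>x\<close> carry no mass of \<open>f\<close>.\<close>

definition cond_dens :: "'a \<Rightarrow> real \<Rightarrow> real" where
  "cond_dens x t = L x t * f (t *\<^sub>R Z x) / enn2real (den x)"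

lemma borel_den [measurable]: "den \<in> borel_measurable borel"
  unfolding den_def by measurable

lemma borel_cond_dens [measurable (raw)]:
  assumes [measurable]: "g \<in> borel_measurable M" "k \<in> borel_measurable M"
  shows "(\<lambda>x. cond_dens (g x) (k x)) \<in> borel_measurable M"
  unfolding cond_dens_def by measurable

lemma cond_dens_nonneg: "0 \<le> cond_dens x t"
  by (simp add: cond_dens_def f_nonneg)

text \<open>The condition \<open>t \<noteq> 0\<close> does not follow from a nonzero weight: in
  dimension one \<open>\<bar>0\<bar> ^ 0 = 1\<close>, while the origin has lost the direction of the
  ray.\<close>

lemma ray_weight_on_ray:
  assumes "L x t \<noteq> 0" "t \<noteq> 0"
  shows "L (t *\<^sub>R Z x) s = L x s" "Z (t *\<^sub>R Z x) = Z x" "H (t *\<^sub>R Z x) = t"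
proof -
  from assms have x: "H x \<noteq> 0" "H (t *\<^sub>R Z x) = t"
    by (auto simp: ray_weight_def split: if_splits)
  then show "Z (t *\<^sub>R Z x) = Z x" "H (t *\<^sub>R Z x) = t"
    using ray_dir_on_ray assms(2) by auto
  then show "L (t *\<^sub>R Z x) s = L x s"
    using x assms(2) by (simp add: ray_weight_def)
qed

lemma den_on_ray:
  assumes "L x t \<noteq> 0" "t \<noteq> 0"
  shows "den (t *\<^sub>R Z x) = den x"
  unfolding den_def using ray_weight_on_ray[OF assms] by simp

lemma AE_nonzero: "AE t in lborel. t \<noteq> (0::real)"
  by (rule AE_lborel_singleton)

text \<open>Restricted to \<open>\<bar>H x\<bar> \<le> n\<close>, the integral of \<open>den\<close>
  can be swapped so that \<open>f\<close> sits at the outer point. Then \<open>t\<close> is confined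
  to \<open>{-n..n}\<close>, and the result is at most \<open>2 * n ^ DIM('a)\<close> times the mass
  of \<open>f\<close>.\<close>

lemma den_finite: "AE x in lborel. H x \<noteq> 0 \<longrightarrow> den x < top"
proof -
  have "AE x in lborel. H x \<noteq> 0 \<and> \<bar>H x\<bar> \<le> real n \<longrightarrow> den x \<noteq> \<infinity>" for n :: nat
  proof -
    define w :: "'a \<Rightarrow> ennreal" where "w x = indicator {x. \<bar>H x\<bar> \<le> real n} x" for x
    have [measurable]: "w \<in> borel_measurable borel" unfolding w_def by measurable
    have "(\<integral>\<^sup>+x. w x * den x \<partial>lborel) = (\<integral>\<^sup>+x. \<integral>\<^sup>+t. L x t * (w x * ennreal (f (t *\<^sub>R Z x))) \<partial>lborel \<partial>lborel)"
      unfolding den_def by (subst nn_integral_cmult[symmetric]) (simp_all add: mult_ac)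
    also have "\<dots> = (\<integral>\<^sup>+y. \<integral>\<^sup>+t. L y t * (w (t *\<^sub>R Z y) * ennreal (f y)) \<partial>lborel \<partial>lborel)"
      by (rule ray_integral_swap) measurable
    also have "\<dots> \<le> (\<integral>\<^sup>+y. \<integral>\<^sup>+t. ennreal (real n ^ (DIM('a) - 1)) * indicator {- real n..real n} t * ennreal (f y) \<partial>lborel \<partial>lborel)"
    proof (intro nn_integral_mono)
      fix y t
      show "ennreal (L y t) * (w (t *\<^sub>R Z y) * ennreal (f y)) \<le> ennreal (real n ^ (DIM('a) - 1)) * indicator {- real n..real n} t * ennreal (f y)"
      proof (cases "L y t = 0 \<or> w (t *\<^sub>R Z y) = 0")
        case False
        then have "H (t *\<^sub>R Z y) = t" "L y t = \<bar>t\<bar> ^ (DIM('a) - 1)" "\<bar>t\<bar> \<le> real n" "t \<in> {- real n..real n}"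
          by (auto simp: ray_weight_def w_def indicator_def split: if_splits)
        then show ?thesis
          by (auto simp: w_def intro!: mult_right_mono ennreal_leI power_mono)
      qed auto
    qed
    also have "\<dots> = (\<integral>\<^sup>+y. ennreal (real n ^ (DIM('a) - 1)) * ennreal (2 * real n) * ennreal (f y) \<partial>lborel)"
      by (simp add: nn_integral_multc nn_integral_cmult_indicator)
    also have "\<dots> < top"
      using f_fin by (simp add: nn_integral_cmult ennreal_mult_less_top)
    finally have "AE x in lborel. w x * den x \<noteq> \<infinity>"
      by (intro nn_integral_PInf_AE) auto
    then show ?thesis
      by eventually_elim (auto simp: w_def)
  qed
  then have "AE x in lborel. \<forall>n::nat. H x \<noteq> 0 \<and> \<bar>H x\<bar> \<le> real n \<longrightarrow> den x \<noteq> \<infinity>"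
    unfolding AE_all_countable by blast
  then show ?thesis
  proof eventually_elim
    case (elim x)
    obtain n :: nat where "\<bar>H x\<bar> \<le> real n" using real_arch_simple by blast
    with elim show ?case by (auto simp: less_top)
  qed
qed

text \<open>Every ray carries weight zero of the bad set \<open>B\<close>: either \<open>den\<close>
  vanishes, and then so does \<open>f\<close> almost everywhere on the ray, or \<open>den\<close> is
  the same nonzero number all along it. After the swap almost every point of \<open>B\<close> would
  have a ray without weight, yet its own half-ray always has some.\<close>

lemma den_pos: "AE x in lborel. f x \<noteq> 0 \<longrightarrow> den x \<noteq> 0"
proof -
  define B where "B = {x. f x \<noteq> 0 \<and> den x = 0 \<and> H x \<noteq> 0}"
  have [measurable]: "B \<in> sets borel" unfolding B_def by measurable
  define w :: "'a \<Rightarrow> ennreal" where "w x = indicator {x. \<bar>H x\<bar> \<le> 1} x" for x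
  have [measurable]: "w \<in> borel_measurable borel" unfolding w_def by measurable
  have ray_null: "(\<integral>\<^sup>+t. L x t * (w x * indicator B (t *\<^sub>R Z x)) \<partial>lborel) = 0" for x
  proof (cases "den x = 0")
    case True
    then have "AE t in lborel. L x t * ennreal (f (t *\<^sub>R Z x)) = 0"
      unfolding den_def by (subst (asm) nn_integral_0_iff_AE) auto
    then have "AE t in lborel. L x t * (w x * indicator B (t *\<^sub>R Z x)) = 0"
      by eventually_elim (use f_nonneg in \<open>auto simp: B_def indicator_def order.antisym\<close>)
    then show ?thesis by (subst nn_integral_0_iff_AE) auto
  next
    case False
    have "AE t in lborel. L x t * (w x * indicator B (t *\<^sub>R Z x)) = 0"
      using AE_nonzero
    proof eventually_elim
      case (elim t)
      show ?case
      proof (cases "L x t = 0")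
        case nz: False
        then have "t *\<^sub>R Z x \<notin> B" using den_on_ray[OF nz elim] False by (simp add: B_def)
        then show ?thesis by simp
      qed simp
    qed
    then show ?thesis by (subst nn_integral_0_iff_AE) auto
  qed
  have "(\<integral>\<^sup>+y. \<integral>\<^sup>+t. L y t * (w (t *\<^sub>R Z y) * indicator B y) \<partial>lborel \<partial>lborel)
    = (\<integral>\<^sup>+x. \<integral>\<^sup>+t. L x t * (w x * indicator B (t *\<^sub>R Z x)) \<partial>lborel \<partial>lborel)"
    by (rule ray_integral_swap[symmetric]) measurable
  also have "\<dots> = 0" by (simp add: ray_null)
  finally have "AE y in lborel. (\<integral>\<^sup>+t. L y t * (w (t *\<^sub>R Z y) * indicator B y) \<partial>lborel) = 0"
    by (subst (asm) nn_integral_0_iff_AE) auto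
  then have "AE y in lborel. y \<notin> B"
  proof eventually_elim
    case (elim y)
    show ?case
    proof
      assume y: "y \<in> B"
      then have Hy: "H y \<noteq> 0" by (simp add: B_def)
      \<comment> \<open>The values of the sign of \<open>H y\<close>: there the point on the ray
        lies on the half-ray of \<open>y\<close> itself, so homogeneity alone makes the weight
        positive.\<close>
      define I where "I = (if H y > 0 then {0<..<1} else {-1<..<0::real})"
      have pos: "L y t * (w (t *\<^sub>R Z y) * indicator B y) \<noteq> 0" if "t \<in> I" for t
      proof -
        have "t / H y > 0" using that Hy by (auto simp: I_def zero_less_divide_iff split: if_splits)
        from hom[OF this, of y] Hy have "H (t *\<^sub>R Z y) = t" by (simp add: ray_dir_def divide_inverse)
        with that Hy y show ?thesis
          by (auto simp: ray_weight_def w_def I_def split: if_splits)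
      qed
      have "AE t in lborel. L y t * (w (t *\<^sub>R Z y) * indicator B y) = 0"
        using elim by (subst (asm) nn_integral_0_iff_AE) auto
      then have "AE t in lborel. t \<notin> I"
        by eventually_elim (use pos in blast)
      then have "emeasure lborel I = 0"
        by (subst (asm) AE_iff_measurable[of I]) (auto simp: I_def)
      then show False by (auto simp: I_def split: if_splits)
    qed
  qed
  with f_supp show ?thesis
    by eventually_elim (auto simp: B_def)
qed

text \<open>The swap for the kernel \<open>f x * f y * F y / den x\<close>: as \<open>den\<close> is
  constant along the ray, the inner integral that remains is \<open>den y\<close> divided by
  itself.\<close>

lemma nn_disintegration:
  fixes F :: "'a \<Rightarrow> ennreal"
  assumes [measurable]: "F \<in> borel_measurable borel"
  shows "(\<integral>\<^sup>+x. \<integral>\<^sup>+t. ennreal (f x * cond_dens x t) * F (t *\<^sub>R Z x) \<partial>lborel \<partial>lborel) = (\<integral>\<^sup>+y. ennreal (f y) * F y \<partial>lborel)"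
proof -
  define k where "k x y = ennreal (f x * f y / enn2real (den x)) * F y" for x y
  have [measurable]: "(\<lambda>(x, y). k x y) \<in> borel_measurable (borel \<Otimes>\<^sub>M borel)" unfolding k_def by measurable
  have "(\<integral>\<^sup>+x. \<integral>\<^sup>+t. ennreal (f x * cond_dens x t) * F (t *\<^sub>R Z x) \<partial>lborel \<partial>lborel)
      = (\<integral>\<^sup>+x. \<integral>\<^sup>+t. L x t * k x (t *\<^sub>R Z x) \<partial>lborel \<partial>lborel)"
    unfolding k_def cond_dens_def mult.assoc[symmetric]
    by (intro nn_integral_cong arg_cong2[where f="(*)"] refl) (simp add: ennreal_mult[symmetric] f_nonneg mult_ac)
  also have "\<dots> = (\<integral>\<^sup>+y. \<integral>\<^sup>+t. L y t * k (t *\<^sub>R Z y) y \<partial>lborel \<partial>lborel)"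
    by (rule ray_integral_swap) measurable
  also have "\<dots> = (\<integral>\<^sup>+y. ennreal (f y) * F y \<partial>lborel)"
  proof (rule nn_integral_cong_AE)
    show "AE y in lborel. (\<integral>\<^sup>+t. L y t * k (t *\<^sub>R Z y) y \<partial>lborel) = ennreal (f y) * F y"
      using f_supp den_finite den_pos
    proof eventually_elim
      case (elim y)
      have "(\<integral>\<^sup>+t. L y t * k (t *\<^sub>R Z y) y \<partial>lborel)
          = (\<integral>\<^sup>+t. ennreal (f y / enn2real (den y)) * F y * (L y t * ennreal (f (t *\<^sub>R Z y))) \<partial>lborel)"
      proof (rule nn_integral_cong_AE)
        show "AE t in lborel. L y t * k (t *\<^sub>R Z y) y = ennreal (f y / enn2real (den y)) * F y * (L y t * ennreal (f (t *\<^sub>R Z y)))"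
          using AE_nonzero
        proof eventually_elim
          case (elim t)
          have "ennreal (f (t *\<^sub>R Z y) * f y / enn2real (den y)) = ennreal (f y / enn2real (den y)) * ennreal (f (t *\<^sub>R Z y))"
            by (simp add: f_nonneg ennreal_mult[symmetric] mult.commute)
          then show ?case
            using den_on_ray[OF _ elim, of y] by (cases "L y t = 0") (simp_all add: k_def mult_ac)
        qed
      qed
      also have "\<dots> = ennreal (f y / enn2real (den y)) * F y * den y"
        unfolding den_def by (rule nn_integral_cmult) measurable
      also have "\<dots> = ennreal (f y) * F y"
      proof (cases "f y = 0")
        case False
        with elim obtain d where d: "den y = ennreal d" "d > 0"
          by (cases "den y") auto
        then have "ennreal (f y / enn2real (den y)) * den y = ennreal (f y)"
          by (simp add: ennreal_mult[symmetric] f_nonneg)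
        then show ?thesis by (metis mult.assoc mult.commute)
      qed simp
      finally show ?case .
    qed
  qed
  finally show ?thesis .
qed

text \<open>The nonnegative identity says that an image measure has density \<open>f\<close>. In
  this form it transports both integrability and value for functions of either sign.\<close>

lemma disintegration:
  fixes u :: "'a \<Rightarrow> real"
  assumes [measurable]: "u \<in> borel_measurable borel" and int: "integrable lborel (\<lambda>x. f x * u x)"
  shows "integrable (lborel \<Otimes>\<^sub>M lborel) (\<lambda>(x, t). f x * (cond_dens x t * u (t *\<^sub>R Z x)))" (is "integrable _ ?I")
    and "(LINT p|(lborel \<Otimes>\<^sub>M lborel). (\<lambda>(x, t). f x * (cond_dens x t * u (t *\<^sub>R Z x))) p) = (LINT x|lborel. f x * u x)"
proof -
  define R where "R = density (lborel \<Otimes>\<^sub>M lborel) (\<lambda>(x, t). ennreal (f x * cond_dens x t))"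
  have Y: "(\<lambda>(x, t). t *\<^sub>R Z x) \<in> borel_measurable (lborel \<Otimes>\<^sub>M lborel)" by measurable
  then have Y': "(\<lambda>(x, t). t *\<^sub>R Z x) \<in> measurable R borel" by (simp add: R_def)
  have eq: "distr R borel (\<lambda>(x, t). t *\<^sub>R Z x) = density lborel f"
  proof (rule measure_eqI)
    fix A assume "A \<in> sets (distr R borel (\<lambda>(x, t). t *\<^sub>R Z x))"
    then have [measurable]: "A \<in> sets borel" by simp
    have "emeasure (distr R borel (\<lambda>(x, t). t *\<^sub>R Z x)) A = (\<integral>\<^sup>+p. indicator A (case p of (x, t) \<Rightarrow> t *\<^sub>R Z x) \<partial>R)"
      using Y' by (subst nn_integral_distr[of _ R borel "indicator A", symmetric]) auto
    also have "\<dots> = (\<integral>\<^sup>+p. (case p of (x, t) \<Rightarrow> ennreal (f x * cond_dens x t) * indicator A (t *\<^sub>R Z x)) \<partial>(lborel \<Otimes>\<^sub>M lborel))"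
      unfolding R_def by (subst nn_integral_density) (auto intro!: nn_integral_cong)
    also have "\<dots> = (\<integral>\<^sup>+x. \<integral>\<^sup>+t. ennreal (f x * cond_dens x t) * indicator A (t *\<^sub>R Z x) \<partial>lborel \<partial>lborel)"
      by (subst lborel.nn_integral_fst[symmetric]) auto
    also have "\<dots> = emeasure (density lborel f) A"
      by (subst nn_disintegration) (auto simp: emeasure_density)
    finally show "emeasure (distr R borel (\<lambda>(x, t). t *\<^sub>R Z x)) A = emeasure (density lborel f) A" .
  qed simp
  have "integrable (density lborel f) u"
    using int by (subst integrable_density) (auto simp: f_nonneg)
  then have i: "integrable R (\<lambda>p. u (case p of (x, t) \<Rightarrow> t *\<^sub>R Z x))"
    unfolding eq[symmetric] using integrable_distr_eq[OF Y', of u] by simp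
  have I: "?I = (\<lambda>p. (case p of (x, t) \<Rightarrow> f x * cond_dens x t) *\<^sub>R u (case p of (x, t) \<Rightarrow> t *\<^sub>R Z x))"
    by (auto simp: fun_eq_iff)
  have R: "R = density (lborel \<Otimes>\<^sub>M lborel) (\<lambda>p. ennreal (case p of (x, t) \<Rightarrow> f x * cond_dens x t))"
    unfolding R_def by (intro arg_cong2[where f=density]) (auto simp: fun_eq_iff)
  have nn: "AE p in lborel \<Otimes>\<^sub>M lborel. 0 \<le> (case p of (x, t) \<Rightarrow> f x * cond_dens x t)"
    by (auto simp: f_nonneg cond_dens_nonneg)
  show "integrable (lborel \<Otimes>\<^sub>M lborel) ?I"
    unfolding I using i nn unfolding R by (subst (asm) integrable_density) auto
  have "(LINT p|(lborel \<Otimes>\<^sub>M lborel). ?I p) = (LINT p|R. u (case p of (x, t) \<Rightarrow> t *\<^sub>R Z x))"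
    unfolding I R using nn by (subst integral_density) auto
  also have "\<dots> = (LINT x|density lborel f. u x)"
    unfolding eq[symmetric] using Y' by (subst integral_distr) auto
  also have "\<dots> = (LINT x|lborel. f x * u x)"
    by (subst integral_density) (auto simp: f_nonneg)
  finally show "(LINT p|(lborel \<Otimes>\<^sub>M lborel). ?I p) = (LINT x|lborel. f x * u x)" .
qed

end

section \<open>Null sets along rays and lines\<close>

lemma emeasure_lborel_vimage_scaleR:
  fixes A :: "'a::euclidean_space set"
  assumes [measurable]: "A \<in> sets borel" and c: "c \<noteq> 0"
  shows "emeasure lborel A = ennreal (\<bar>c\<bar> ^ DIM('a)) * emeasure lborel {x. c *\<^sub>R x \<in> A}"
proof -
  have "(\<integral>\<^sup>+x. indicator A (c *\<^sub>R x) \<partial>lborel) = (\<integral>\<^sup>+x. indicator {x. c *\<^sub>R x \<in> A} x \<partial>lborel)"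
    by (intro nn_integral_cong) (auto split: split_indicator)
  then show ?thesis
    using nn_integral_lborel_scaleR[of "indicator A" c] c by simp
qed

lemma lborel_AE_commute:
  assumes "Measurable.pred (lborel \<Otimes>\<^sub>M lborel) (\<lambda>p. P (fst p) (snd p))"
  shows "(AE x in lborel. AE y in lborel. P x y) \<longleftrightarrow> (AE y in lborel. AE x in lborel. P x y)"
  using assms by (intro lborel_pair.AE_commute) (simp add: pred_def)

text \<open>For each fixed \<open>s \<noteq> 0\<close> the points scaled into \<open>N\<close> form
  a null set; Fubini exchanges the two quantifiers.\<close>

lemma AE_ray_notin_null:
  fixes N :: "'a::euclidean_space set"
  assumes N: "N \<in> null_sets lborel"
  shows "AE x in lborel. AE s in lborel. s \<noteq> 0 \<longrightarrow> s *\<^sub>R x \<notin> N"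
proof -
  have [measurable]: "N \<in> sets borel" using N by auto
  have "AE s in lborel. AE x in lborel. s \<noteq> 0 \<longrightarrow> s *\<^sub>R x \<notin> N"
  proof (rule AE_I2)
    fix s :: real
    show "AE x in lborel. s \<noteq> 0 \<longrightarrow> s *\<^sub>R x \<notin> N"
    proof (cases "s = 0")
      case False
      then have "emeasure lborel {x. s *\<^sub>R x \<in> N} = 0"
        using emeasure_lborel_vimage_scaleR[of N s] N by auto
      then have "{x. s *\<^sub>R x \<in> N} \<in> null_sets lborel" by (auto simp: null_sets_def)
      from AE_not_in[OF this] show ?thesis by simp
    qed simp
  qed
  then show ?thesis
    by (rule lborel_AE_commute[THEN iffD2, rotated]) measurable
qed

text \<open>Polar coordinates without a sphere: after exchanging the quantifiers, some single factor
  \<open>s > 0\<close> sends almost no point into \<open>B\<close>, and scaling back makes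
  \<open>B\<close> itself null.\<close>

lemma null_set_of_null_rays:
  fixes B :: "'a::euclidean_space set"
  assumes [measurable]: "B \<in> sets borel"
    and rays: "\<And>x. x \<in> B \<Longrightarrow> AE s in lborel. 0 < s \<longrightarrow> s *\<^sub>R x \<notin> B"
  shows "B \<in> null_sets lborel"
proof -
  have ray: "AE s in lborel. 0 < s \<longrightarrow> s *\<^sub>R x \<notin> B" for x
  proof (cases "\<exists>r>0. r *\<^sub>R x \<in> B")
    case True
    then obtain r where r: "r > 0" "r *\<^sub>R x \<in> B" by blast
    have "AE s in lborel. 0 < 0 + inverse r * s \<longrightarrow> (0 + inverse r * s) *\<^sub>R r *\<^sub>R x \<notin> B"
      using r by (intro AE_borel_affine[OF _ _ rays[OF r(2)]]) auto
    then show ?thesis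
      by eventually_elim (use r in \<open>auto simp: field_simps\<close>)
  next
    case False
    then show ?thesis by auto
  qed
  then have "AE x in lborel. AE s in lborel. 0 < s \<longrightarrow> s *\<^sub>R x \<notin> B" by simp
  then have "AE s in lborel. AE x in lborel. 0 < s \<longrightarrow> s *\<^sub>R x \<notin> B"
    by (rule lborel_AE_commute[THEN iffD1, rotated]) measurable
  then have *: "AE s in lborel. 0 < s \<longrightarrow> (AE x in lborel. s *\<^sub>R x \<notin> B)"
    by eventually_elim auto
  have "\<exists>s>0. AE x in lborel. s *\<^sub>R x \<notin> B"
  proof (rule ccontr)
    assume "\<not> ?thesis"
    with * have "AE s in lborel. s \<notin> {0<..<1::real}"
      by (auto elim!: eventually_mono)
    then have "emeasure lborel {0<..<1::real} = 0"
      by (subst (asm) AE_iff_measurable[of "{0<..<1::real}"]) auto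
    then show False by simp
  qed
  then obtain s where s: "s > 0" "AE x in lborel. s *\<^sub>R x \<notin> B" by blast
  then have "emeasure lborel {x. s *\<^sub>R x \<in> B} = 0"
    by (subst (asm) AE_iff_measurable[of "{x. s *\<^sub>R x \<in> B}"]) auto
  then show ?thesis
    using emeasure_lborel_vimage_scaleR[of B s] s by (auto simp: null_sets_def)
qed

text \<open>\<open>T d\<close> collects the points of \<open>S\<close> whose line has a null section
  of \<open>S\<close> within distance \<open>d\<close>. An interval of length \<open>d\<close> that
  meets \<open>T d\<close> then meets \<open>S\<close> in a null set, so \<open>T d\<close> is null
  on every parallel line and hence null. At the remaining points the section has positive length at
  every scale, which is more than one further point.\<close>

lemma AE_not_isolated_on_line:
  fixes S :: "'a::euclidean_space set"
  assumes [measurable]: "S \<in> sets borel"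
  shows "AE x in lborel. x \<in> S \<longrightarrow> (\<forall>d>0. \<exists>s. 0 < \<bar>s\<bar> \<and> \<bar>s\<bar> < d \<and> x + s *\<^sub>R v \<in> S)"
proof -
  define T where "T d = {x \<in> S. (\<integral>\<^sup>+s. indicator S (x + s *\<^sub>R v) * indicator {-d<..<d} s \<partial>lborel) = 0}" for d :: real
  have T_meas [measurable]: "T d \<in> sets borel" for d
    unfolding T_def by measurable
  have sparse: "AE s in lborel. x + s *\<^sub>R v \<notin> T d" if "d > 0" for x d
  proof -
    have near: "AE s in lborel. x + s *\<^sub>R v \<in> T d \<longrightarrow> \<not> (a < s \<and> s < a + d)" for a
    proof (cases "\<exists>s0. a < s0 \<and> s0 < a + d \<and> x + s0 *\<^sub>R v \<in> T d")
      case True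
      then obtain s0 where s0: "a < s0" "s0 < a + d" "x + s0 *\<^sub>R v \<in> T d" by blast
      then have "(\<integral>\<^sup>+s. indicator S ((x + s0 *\<^sub>R v) + s *\<^sub>R v) * indicator {-d<..<d} s \<partial>lborel) = 0"
        by (simp add: T_def)
      then have "AE s in lborel. indicator S ((x + s0 *\<^sub>R v) + s *\<^sub>R v) * indicator {-d<..<d} s = (0::ennreal)"
        by (subst (asm) nn_integral_0_iff_AE) auto
      then have "AE s in lborel. indicator S ((x + s0 *\<^sub>R v) + (- s0 + 1 * s) *\<^sub>R v) * indicator {-d<..<d} (- s0 + 1 * s) = (0::ennreal)"
        by (intro AE_borel_affine) auto
      then show ?thesis
      proof eventually_elim
        case (elim s)
        show ?case
        proof (intro impI notI)
          assume s: "x + s *\<^sub>R v \<in> T d" "a < s \<and> s < a + d"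
          have "(x + s0 *\<^sub>R v) + (- s0 + 1 * s) *\<^sub>R v = x + s *\<^sub>R v" by (simp add: algebra_simps)
          moreover have "x + s *\<^sub>R v \<in> S" using s by (simp add: T_def)
          ultimately have "(x + s0 *\<^sub>R v) + (- s0 + 1 * s) *\<^sub>R v \<in> S" by (simp only:)
          moreover have "- s0 + 1 * s \<in> {-d<..<d}" using s s0 by auto
          ultimately show False using elim by simp
        qed
      qed
    next
      case False
      then show ?thesis by auto
    qed
    \<comment> \<open>Open intervals of length \<open>d\<close> at spacing \<open>d/2\<close>
      overlap, so countably many of them cover the line.\<close>
    have "AE s in lborel. \<forall>k::int. x + s *\<^sub>R v \<in> T d \<longrightarrow> \<not> (of_int k * (d/2) < s \<and> s < of_int k * (d/2) + d)"
      unfolding AE_all_countable using near by blast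
    then show ?thesis
    proof eventually_elim
      case (elim s)
      show ?case
      proof
        assume "x + s *\<^sub>R v \<in> T d"
        define k where "k = \<lceil>s / (d/2)\<rceil> - 1"
        have "of_int k < s / (d/2)" "s / (d/2) \<le> of_int k + 1"
          unfolding k_def by linarith+
        then have "of_int k * (d/2) < s" "s \<le> (of_int k + 1) * (d/2)"
          using that by (simp_all add: field_simps)
        then have "of_int k * (d/2) < s \<and> s < of_int k * (d/2) + d"
          using that by (simp add: algebra_simps)
        with elim \<open>x + s *\<^sub>R v \<in> T d\<close> show False by blast
      qed
    qed
  qed
  have null: "T d \<in> null_sets lborel" if "d > 0" for d
  proof -
    have "AE x in lborel. AE s in lborel. x + s *\<^sub>R v \<notin> T d" using sparse[OF that] by simp
    then have "AE s in lborel. AE x in lborel. x + s *\<^sub>R v \<notin> T d"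
      by (rule lborel_AE_commute[THEN iffD1, rotated]) measurable
    \<comment> \<open>One good shift is enough, since Lebesgue measure is translation
      invariant.\<close>
    then have "\<exists>s. AE x in lborel. x + s *\<^sub>R v \<notin> T d"
      by (auto dest!: eventually_happens simp: trivial_limit_def[symmetric] ae_filter_eq_bot_iff)
    then obtain s where "AE x in lborel. x + s *\<^sub>R v \<notin> T d" by blast
    then have "AE x in distr lborel borel ((+) (s *\<^sub>R v)). x \<notin> T d"
      by (subst AE_distr_iff) (auto simp: add.commute)
    then have "AE x in lborel. x \<notin> T d"
      unfolding lborel_distr_plus .
    then show ?thesis
      by (subst (asm) AE_iff_measurable[of "T d"]) auto
  qed
  have "AE x in lborel. \<forall>n::nat. x \<notin> T (1 / Suc n)"
    unfolding AE_all_countable using null AE_not_in by (metis of_nat_0_less_iff zero_less_Suc zero_less_divide_1_iff)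
  then show ?thesis
  proof eventually_elim
    case (elim x)
    show ?case
    proof (intro impI allI)
      fix d :: real assume x: "x \<in> S" and d: "d > 0"
      show "\<exists>s. 0 < \<bar>s\<bar> \<and> \<bar>s\<bar> < d \<and> x + s *\<^sub>R v \<in> S"
      proof (rule ccontr)
        assume no: "\<not> ?thesis"
        obtain n where n: "1 / real (Suc n) < d"
          using d by (metis reals_Archimedean inverse_eq_divide)
        have "(\<integral>\<^sup>+s. indicator S (x + s *\<^sub>R v) * indicator {-(1 / Suc n)<..<1 / Suc n} s \<partial>lborel) = 0"
        proof (subst nn_integral_0_iff_AE)
          have "AE s in lborel. s \<noteq> (0::real)" by (rule AE_lborel_singleton)
          then show "AE s in lborel. indicator S (x + s *\<^sub>R v) * indicator {-(1 / Suc n)<..<1 / Suc n} s = (0::ennreal)"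
          proof eventually_elim
            case (elim s)
            have "s \<notin> {-(1 / Suc n)<..<1 / Suc n}" if "x + s *\<^sub>R v \<in> S"
            proof
              assume "s \<in> {-(1 / Suc n)<..<1 / Suc n}"
              then have "\<bar>s\<bar> < 1 / real (Suc n)" by auto
              with n have "\<bar>s\<bar> < d" by linarith
              with no that elim show False by auto
            qed
            then show ?case by (auto split: split_indicator)
          qed
        qed auto
        with x elim show False by (auto simp: T_def)
      qed
    qed
  qed
qed

lemma DERIV_zero_if_accumulating_zeros:
  fixes k :: "real \<Rightarrow> real"
  assumes "(k has_real_derivative D) (at 0)" "k 0 = 0"
    and "\<And>d. d > 0 \<Longrightarrow> \<exists>s. 0 < \<bar>s\<bar> \<and> \<bar>s\<bar> < d \<and> k s = 0"
  shows "D = 0"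
proof (rule ccontr)
  assume "D \<noteq> 0"
  have "((\<lambda>s. k s / s) \<longlongrightarrow> D) (at 0)"
    using assms(1,2) by (simp add: has_field_derivative_iff)
  then obtain d where "d > 0" "\<And>s. s \<noteq> 0 \<Longrightarrow> \<bar>s\<bar> < d \<Longrightarrow> \<bar>k s / s - D\<bar> < \<bar>D\<bar>"
    using \<open>D \<noteq> 0\<close> unfolding LIM_def by (metis diff_zero dist_real_def zero_less_abs_iff)
  with assms(3)[of d] show False by force
qed

section \<open>Homogeneous functions\<close>

lemma pos_homogeneousD: "pos_homogeneous h \<Longrightarrow> 0 < t \<Longrightarrow> h (t *\<^sub>R x) = t * h x"
  by (simp add: pos_homogeneous_def)

lemma DERIV_line_scale:
  assumes h: "pos_homogeneous h" and t: "0 < t"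
    and D: "((\<lambda>s. h (x + s *\<^sub>R v)) has_real_derivative D) (at 0)"
  shows "((\<lambda>s. h (t *\<^sub>R x + s *\<^sub>R v)) has_real_derivative D) (at 0)"
proof -
  have "((\<lambda>s. t * h (x + (s / t) *\<^sub>R v)) has_real_derivative t * (D * (1 / t))) (at 0)"
    using t D by (intro DERIV_cmult DERIV_chain2[where f="\<lambda>s. h (x + s *\<^sub>R v)"]) (auto intro!: derivative_eq_intros)
  moreover have "t * h (x + (s / t) *\<^sub>R v) = h (t *\<^sub>R x + s *\<^sub>R v)" for s
    using pos_homogeneousD[OF h t, of "x + (s / t) *\<^sub>R v"] t by (simp add: scaleR_add_right)
  ultimately show ?thesis using t by simp
qed

text \<open>The difference quotients at both points have the same limits, if any, so the values of
  \<open>deriv\<close> agree even where no derivative exists. This makes the gradient norm constant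
  on every half-ray without exception.\<close>

lemma partial_deriv_scale:
  assumes h: "pos_homogeneous h" and t: "0 < t"
  shows "partial_deriv h i (t *\<^sub>R x) = partial_deriv h i x"
proof -
  have "((\<lambda>s. h (t *\<^sub>R x + s *\<^sub>R axis i 1)) has_real_derivative D) (at 0)
      \<longleftrightarrow> ((\<lambda>s. h (x + s *\<^sub>R axis i 1)) has_real_derivative D) (at 0)" for D
    using DERIV_line_scale[OF h t, of x "axis i 1"] DERIV_line_scale[OF h, of "inverse t" "t *\<^sub>R x" "axis i 1"] t
    by auto
  then show ?thesis by (simp add: partial_deriv_def deriv_def)
qed

lemma differentiable_scale:
  assumes h: "pos_homogeneous h" and t: "0 < t" and D: "h differentiable (at (t *\<^sub>R x))"
  shows "h differentiable (at x)"
proof -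
  from D obtain h' where h': "(h has_derivative h') (at (t *\<^sub>R x))" by (auto simp: differentiable_def)
  have "((\<lambda>y. h (t *\<^sub>R y)) has_derivative (\<lambda>v. h' (t *\<^sub>R v))) (at x)"
    using h' by (intro has_derivative_compose[of "\<lambda>y. t *\<^sub>R y" "\<lambda>v. t *\<^sub>R v" x UNIV h h']
        has_derivative_scaleR_right has_derivative_ident)
  from has_derivative_mult_right[OF this, of "inverse t"]
  have "(\<lambda>y. inverse t * h (t *\<^sub>R y)) differentiable (at x)"
    by (rule differentiableI)
  moreover have "inverse t * h (t *\<^sub>R y) = h y" for y
    using pos_homogeneousD[OF h t, of y] t by simp
  ultimately show ?thesis by simp
qed

lemma DERIV_line:
  assumes "(h has_derivative h') (at (x :: 'a::real_normed_vector))"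
  shows "((\<lambda>s. h (x + s *\<^sub>R v)) has_real_derivative h' v) (at 0)"
proof -
  interpret bounded_linear h' using assms by (rule has_derivative_bounded_linear)
  have "((\<lambda>s. h (x + s *\<^sub>R v)) has_derivative (\<lambda>s. h' (s *\<^sub>R v))) (at 0)"
    using assms by (intro has_derivative_compose[of "\<lambda>s. x + s *\<^sub>R v" _ _ _ h]) (auto intro!: derivative_eq_intros)
  then show ?thesis
    by (simp add: has_field_derivative_def scaleR mult.commute[of _ "h' v"])
qed

lemma partial_deriv_eq:
  "(h has_derivative h') (at x) \<Longrightarrow> partial_deriv h i x = h' (axis i 1)"
  unfolding partial_deriv_def by (rule DERIV_imp_deriv[OF DERIV_line])

lemma euler_homogeneous:
  assumes h: "pos_homogeneous h" and D: "(h has_derivative h') (at x)"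
  shows "h' x = h x"
proof -
  have "((\<lambda>s. (1 + s) * h x) has_real_derivative h x) (at 0)"
    by (auto intro!: derivative_eq_intros)
  moreover have "\<forall>\<^sub>F s in nhds 0. h (x + s *\<^sub>R x) = (1 + s) * h x"
  proof (rule eventually_mono[OF eventually_nhds_in_open[of "{-1<..}"]])
    fix s :: real assume "s \<in> {-1<..}"
    then show "h (x + s *\<^sub>R x) = (1 + s) * h x"
      using pos_homogeneousD[OF h, of "1 + s" x] by (simp add: scaleR_add_left)
  qed auto
  ultimately have "((\<lambda>s. h (x + s *\<^sub>R x)) has_real_derivative h x) (at 0)"
    by (subst DERIV_cong_ev[OF refl _ refl]) auto
  with DERIV_line[OF D] show ?thesis by (rule DERIV_unique)
qed

text \<open>By Euler's identity \<open>h x\<close> is the inner product of \<open>x\<close> with the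
  gradient, so a vanishing gradient would force \<open>h x = 0\<close>.\<close>

lemma gradient_norm_pos:
  fixes h :: "real^'m \<Rightarrow> real"
  assumes h: "pos_homogeneous h" and D: "h differentiable (at x)" and nz: "h x \<noteq> 0"
  shows "0 < sqrt (\<Sum>i\<in>UNIV. (partial_deriv h i x)\<^sup>2)"
proof -
  from D obtain h' where D: "(h has_derivative h') (at x)" by (auto simp: differentiable_def)
  interpret bounded_linear h' using D by (rule has_derivative_bounded_linear)
  have "h x = h' (\<Sum>i\<in>UNIV. x $ i *\<^sub>R axis i 1)"
    using euler_homogeneous[OF h D] by (simp add: basis_expansion scalar_mult_eq_scaleR[symmetric])
  also have "\<dots> = (\<Sum>i\<in>UNIV. x $ i * partial_deriv h i x)"
    by (simp add: sum scaleR partial_deriv_eq[OF D])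
  finally have eq: "h x = (\<Sum>i\<in>UNIV. x $ i * partial_deriv h i x)" .
  have "\<not> (\<forall>i. partial_deriv h i x = 0)"
  proof
    assume "\<forall>i. partial_deriv h i x = 0"
    with eq nz show False by simp
  qed
  then obtain i where "partial_deriv h i x \<noteq> 0" by blast
  then have "0 < (\<Sum>i\<in>UNIV. (partial_deriv h i x)\<^sup>2)"
    by (intro sum_pos2[of UNIV i]) auto
  then show ?thesis by simp
qed

text \<open>Where \<open>h\<close> is odd, \<open>y \<mapsto> h y + h (- y)\<close> vanishes, and a zero set meets almost every parallel line
  without isolated points, so all its directional derivatives vanish there.\<close>
lemma AE_partial_deriv_antipodal:
  fixes h :: "real^'m \<Rightarrow> real"
  assumes S: "S \<in> sets borel"
    and D: "\<And>x. x \<in> S \<Longrightarrow> h differentiable (at x) \<and> h differentiable (at (- x)) \<and> h (- x) = - h x"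
  shows "AE x in lborel. x \<in> S \<longrightarrow> (\<forall>i. partial_deriv h i (- x) = partial_deriv h i x)"
proof -
  have "AE x in lborel. \<forall>i. x \<in> S \<longrightarrow> (\<forall>d>0. \<exists>s. 0 < \<bar>s\<bar> \<and> \<bar>s\<bar> < d \<and> x + s *\<^sub>R axis i 1 \<in> S)"
    unfolding AE_all_countable using AE_not_isolated_on_line[OF S] by blast
  then show ?thesis
  proof eventually_elim
    case (elim x)
    show ?case
    proof (intro impI allI)
      fix i assume x: "x \<in> S"
      from D[OF x] obtain h1 h2 where h1: "(h has_derivative h1) (at x)" and h2: "(h has_derivative h2) (at (- x))"
        by (auto simp: differentiable_def)
      interpret h2: bounded_linear h2 using h2 by (rule has_derivative_bounded_linear)
      let ?e = "axis i 1 :: real^'m"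
      have deriv: "((\<lambda>s. h (x + s *\<^sub>R ?e) + h (- x + s *\<^sub>R (- ?e))) has_real_derivative h1 ?e + h2 (- ?e)) (at 0)"
        by (intro DERIV_add DERIV_line h1 h2)
      have zeros: "\<exists>s. 0 < \<bar>s\<bar> \<and> \<bar>s\<bar> < d \<and> h (x + s *\<^sub>R ?e) + h (- x + s *\<^sub>R (- ?e)) = 0" if d: "d > 0" for d
      proof -
        obtain s where s: "0 < \<bar>s\<bar>" "\<bar>s\<bar> < d" "x + s *\<^sub>R ?e \<in> S" using elim x d by blast
        from D[OF s(3)] have "h (- x + s *\<^sub>R (- ?e)) = - h (x + s *\<^sub>R ?e)" by simp
        with s show ?thesis by (intro exI[of _ s]) simp
      qed
      have "h1 ?e + h2 (- ?e) = 0"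
        by (rule DERIV_zero_if_accumulating_zeros[OF deriv _ zeros]) (use D[OF x] in simp)
      then show "partial_deriv h i (- x) = partial_deriv h i x"
        by (simp add: partial_deriv_eq[OF h1] partial_deriv_eq[OF h2] h2.neg)
    qed
  qed
qed

text \<open>By homogeneity one point of differentiability makes its whole half-ray one. Taking half-rays that meet
  \<open>\<Omega> - N\<close> in positive length keeps \<open>D\<close> Borel, which the cone over \<open>\<Omega> - N\<close> need not be.\<close>
lemma differentiability_cone:
  fixes h :: "real^'m \<Rightarrow> real"
  assumes \<Omega> [measurable]: "\<Omega> \<in> sets borel" and h: "pos_homogeneous h"
    and N: "N \<in> null_sets lebesgue" "\<And>x. x \<in> \<Omega> - N \<Longrightarrow> h differentiable (at x)"
  obtains D N0 where "D \<in> sets borel" "N0 \<in> null_sets lborel" "\<Omega> - N0 \<subseteq> D"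
    "\<And>x. x \<in> D \<Longrightarrow> h differentiable (at x)" "\<And>x t. 0 < t \<Longrightarrow> t *\<^sub>R x \<in> D \<longleftrightarrow> x \<in> D"
proof -
  from N(1) obtain N' where N': "N' \<in> null_sets lborel" "N \<subseteq> N'"
    unfolding null_sets_completion_iff2 by blast
  then have [measurable]: "N' \<in> sets borel" by auto
  define D where "D = {x. (\<integral>\<^sup>+s. indicator (\<Omega> - N') (s *\<^sub>R x) * indicator {0<..} s \<partial>lborel) \<noteq> 0}"
  have D_meas [measurable]: "D \<in> sets borel" unfolding D_def by measurable
  have D_iff: "x \<notin> D \<longleftrightarrow> (AE s in lborel. 0 < s \<longrightarrow> s *\<^sub>R x \<notin> \<Omega> - N')" for x
  proof -
    have "x \<notin> D \<longleftrightarrow> (AE s in lborel. indicator (\<Omega> - N') (s *\<^sub>R x) * indicator {0<..} s = (0::ennreal))"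
      unfolding D_def by (subst nn_integral_0_iff_AE[symmetric]) auto
    also have "\<dots> \<longleftrightarrow> (AE s in lborel. 0 < s \<longrightarrow> s *\<^sub>R x \<notin> \<Omega> - N')"
      by (intro AE_cong) (auto split: split_indicator)
    finally show ?thesis .
  qed
  have mono: "t *\<^sub>R x \<notin> D" if "x \<notin> D" "0 < t" for x t
  proof -
    have "AE s in lborel. 0 < 0 + t * s \<longrightarrow> (0 + t * s) *\<^sub>R x \<notin> \<Omega> - N'"
    proof (rule AE_borel_affine[where P="\<lambda>s. 0 < s \<longrightarrow> s *\<^sub>R x \<notin> \<Omega> - N'"])
      show "AE s in lborel. 0 < s \<longrightarrow> s *\<^sub>R x \<notin> \<Omega> - N'" using that by (simp only: D_iff)
      show "t \<noteq> 0" using that by simp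
    qed measurable
    then show ?thesis
      unfolding D_iff
    proof eventually_elim
      case (elim s)
      then show ?case using that(2) by (simp add: mult.commute[of s])
    qed
  qed
  have cone: "t *\<^sub>R x \<in> D \<longleftrightarrow> x \<in> D" if "0 < t" for x t
  proof -
    have "inverse t *\<^sub>R t *\<^sub>R x = x" "0 < inverse t" using that by auto
    then show ?thesis using mono[of x t] mono[of "t *\<^sub>R x" "inverse t"] that by metis
  qed
  have diff: "h differentiable (at x)" if "x \<in> D" for x
  proof -
    have "\<exists>s>0. s *\<^sub>R x \<in> \<Omega> - N'" using that D_iff[of x] by (metis (mono_tags, lifting) AE_I2)
    then obtain s where "0 < s" "s *\<^sub>R x \<in> \<Omega> - N" using N'(2) by blast
    then show ?thesis using N(2) differentiable_scale[OF h] by simp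
  qed
  \<comment> \<open>A point lies outside \<open>D\<close> exactly when its half-ray meets
    \<open>\<Omega> - N'\<close> in length zero, so the uncovered rest of
    \<open>\<Omega> - N'\<close> has only null rays.\<close>
  have B: "\<Omega> - N' - D \<in> null_sets lborel"
  proof (rule null_set_of_null_rays)
    fix x assume "x \<in> \<Omega> - N' - D"
    then have "AE s in lborel. 0 < s \<longrightarrow> s *\<^sub>R x \<notin> \<Omega> - N'" using D_iff[of x] by auto
    then show "AE s in lborel. 0 < s \<longrightarrow> s *\<^sub>R x \<notin> \<Omega> - N' - D" by eventually_elim auto
  qed measurable
  show thesis
  proof (rule that[of D "N' \<union> (\<Omega> - N' - D)"])
    show "N' \<union> (\<Omega> - N' - D) \<in> null_sets lborel" using N'(1) B by (rule null_sets.Un)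
  qed (use cone diff D_meas in auto)
qed

section \<open>Ray integrands and expectations\<close>

lemma AE_neq_ereal: "AE t in lborel. ereal t \<noteq> c"
proof (cases c)
  case (real r)
  then show ?thesis using AE_lborel_singleton[of r] by simp
qed auto

text \<open>Replaces an interval with a possibly infinite end by a half-line, the form in which the
  integral is differentiated. The bound on the support is weak because \<open>h\<close> may attain
  \<open>c0\<close>; the endpoints are null anyway.\<close>

lemma interval_integral_upto:
  fixes \<psi> :: "real \<Rightarrow> real"
  assumes [measurable]: "\<psi> \<in> borel_measurable borel"
    and c: "c0 < ereal b" and supp: "\<And>t. \<psi> t \<noteq> 0 \<Longrightarrow> c0 \<le> ereal t"
  shows "(LBINT t=c0..ereal b. \<psi> t) = (LINT t:{..b}|lborel. \<psi> t)"
proof -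
  have "(LBINT t=c0..ereal b. \<psi> t) = (LINT t:einterval c0 (ereal b)|lborel. \<psi> t)"
    using c by (simp add: interval_lebesgue_integral_def less_imp_le)
  also have "\<dots> = (LINT t:{..b}|lborel. \<psi> t)"
    unfolding set_lebesgue_integral_def
  proof (rule integral_cong_AE)
    show "AE t in lborel. indicat_real (einterval c0 (ereal b)) t *\<^sub>R \<psi> t = indicat_real {..b} t *\<^sub>R \<psi> t"
      using AE_neq_ereal[of c0] AE_neq_ereal[of "ereal b"]
    proof eventually_elim
      case (elim t)
      then show ?case
        using supp[of t] by (cases "\<psi> t = 0") (auto simp: einterval_def indicator_def order.order_iff_strict)
    qed
  qed measurable
  finally show ?thesis .
qed

lemma interval_integral_whole:
  fixes \<psi> :: "real \<Rightarrow> real"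
  assumes [measurable]: "\<psi> \<in> borel_measurable borel"
    and c: "c0 < c1" and supp: "\<And>t. \<psi> t \<noteq> 0 \<Longrightarrow> c0 \<le> ereal t \<and> ereal t \<le> c1"
  shows "(LBINT t=c0..c1. \<psi> t) = (LINT t|lborel. \<psi> t)"
proof -
  have "(LBINT t=c0..c1. \<psi> t) = (LINT t:einterval c0 c1|lborel. \<psi> t)"
    using c by (simp add: interval_lebesgue_integral_def less_imp_le)
  also have "\<dots> = (LINT t|lborel. \<psi> t)"
    unfolding set_lebesgue_integral_def
  proof (rule integral_cong_AE)
    show "AE t in lborel. indicat_real (einterval c0 c1) t *\<^sub>R \<psi> t = \<psi> t"
      using AE_neq_ereal[of c0] AE_neq_ereal[of c1]
    proof eventually_elim
      case (elim t)
      then show ?case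
        using supp[of t] by (cases "\<psi> t = 0") (auto simp: einterval_def indicator_def order.order_iff_strict)
    qed
  qed measurable
  finally show ?thesis .
qed

lemma mem_ubar_iff:
  "(z, t) \<in> ubar h ` (\<Omega> - {x \<in> \<Omega>. h x = 0}) \<longleftrightarrow> t \<noteq> 0 \<and> t *\<^sub>R z \<in> \<Omega> \<and> h (t *\<^sub>R z) = t"
proof
  assume "(z, t) \<in> ubar h ` (\<Omega> - {x \<in> \<Omega>. h x = 0})"
  then obtain x where "x \<in> \<Omega>" "h x \<noteq> 0" "z = x /\<^sub>R h x" "t = h x" by (auto simp: ubar_def)
  then show "t \<noteq> 0 \<and> t *\<^sub>R z \<in> \<Omega> \<and> h (t *\<^sub>R z) = t" by simp
next
  assume t: "t \<noteq> 0 \<and> t *\<^sub>R z \<in> \<Omega> \<and> h (t *\<^sub>R z) = t"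
  then show "(z, t) \<in> ubar h ` (\<Omega> - {x \<in> \<Omega>. h x = 0})"
    by (intro image_eqI[of _ _ "t *\<^sub>R z"]) (auto simp: ubar_def)
qed

definition grad_norm :: "(real^'m \<Rightarrow> real) \<Rightarrow> real^'m \<Rightarrow> real" where
  "grad_norm h x = sqrt (\<Sum>i\<in>UNIV. (partial_deriv h i x)\<^sup>2)"

lemma grad_norm_scale: "pos_homogeneous h \<Longrightarrow> 0 < t \<Longrightarrow> grad_norm h (t *\<^sub>R x) = grad_norm h x"
  by (simp add: grad_norm_def partial_deriv_scale)

text \<open>On the image of \<open>ubar\<close>, \<open>t = h (t *\<^sub>R z) = \<bar>t\<bar> * h
  (sgn t *\<^sub>R z)\<close>, so the factor \<open>\<bar>h (sgn t *\<^sub>R z)\<bar>\<close> is 1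
  and the surviving power of \<open>\<bar>t\<bar>\<close> is the one in the denominator of
  \<open>Jbar\<close>.\<close>

lemma ray_integrand_simp:
  fixes h :: "real^'m \<Rightarrow> real"
  assumes h: "pos_homogeneous h"
  shows "ray_integrand \<Omega> h \<phi> z t =
    (if t \<noteq> 0 \<and> t *\<^sub>R z \<in> \<Omega> \<and> h (t *\<^sub>R z) = t
     then \<bar>t\<bar> ^ (CARD('m) - 1) * \<phi> (t *\<^sub>R z) / grad_norm h (t *\<^sub>R z) else 0)"
proof (cases "t \<noteq> 0 \<and> t *\<^sub>R z \<in> \<Omega> \<and> h (t *\<^sub>R z) = t")
  case True
  then have t: "0 < \<bar>t\<bar>" by simp
  have "t = \<bar>t\<bar> * h (sgn t *\<^sub>R z)"
    using pos_homogeneousD[OF h t, of "sgn t *\<^sub>R z"] True by (simp add: abs_mult_sgn)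
  then have "\<bar>t\<bar> * \<bar>h (sgn t *\<^sub>R z)\<bar> = \<bar>t\<bar> * 1" by (metis abs_mult abs_abs mult.right_neutral)
  then have "\<bar>h (sgn t *\<^sub>R z)\<bar> = 1" using True by simp
  with True show ?thesis
    unfolding ray_integrand_def mem_ubar_iff Jbar_def grad_norm_def[symmetric]
    by (simp add: field_simps)
next
  case False
  show ?thesis
    unfolding ray_integrand_def mem_ubar_iff if_not_P[OF False] ..
qed

text \<open>Measurability is needed for every \<open>z\<close>, since the integral of a function that is not Borel is \<open>0\<close>; the
  gradient norm causes no trouble because it is constant on each half-ray.\<close>
lemma borel_ray_integrand:
  fixes h :: "real^'m \<Rightarrow> real"
  assumes h: "pos_homogeneous h" and [measurable]: "\<Omega> \<in> sets borel" "\<phi> \<in> borel_measurable borel"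
  shows "ray_integrand \<Omega> h \<phi> z \<in> borel_measurable borel"
proof -
  \<comment> \<open>On a half-ray the equation \<open>h (t *\<^sub>R z) = t\<close> reduces to
    \<open>h z = 1\<close> or \<open>h (- z) = - 1\<close>, which does not involve \<open>t\<close>;
    no measurability of \<open>h\<close> enters.\<close>
  have "ray_integrand \<Omega> h \<phi> z = (\<lambda>t. if t *\<^sub>R z \<in> \<Omega> then
      (if 0 < t \<and> h z = 1 then \<bar>t\<bar> ^ (CARD('m) - 1) * \<phi> (t *\<^sub>R z) / grad_norm h z
       else if t < 0 \<and> h (- z) = - 1 then \<bar>t\<bar> ^ (CARD('m) - 1) * \<phi> (t *\<^sub>R z) / grad_norm h (- z) else 0) else 0)"
  proof
    fix t :: real
    consider "0 < t" | "t < 0" | "t = 0" by linarith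
    then show "ray_integrand \<Omega> h \<phi> z t = (if t *\<^sub>R z \<in> \<Omega> then
      (if 0 < t \<and> h z = 1 then \<bar>t\<bar> ^ (CARD('m) - 1) * \<phi> (t *\<^sub>R z) / grad_norm h z
       else if t < 0 \<and> h (- z) = - 1 then \<bar>t\<bar> ^ (CARD('m) - 1) * \<phi> (t *\<^sub>R z) / grad_norm h (- z) else 0) else 0)"
    proof cases
      case 1
      then show ?thesis
        by (simp add: ray_integrand_simp[OF h] pos_homogeneousD[OF h] grad_norm_scale[OF h])
    next
      case 2
      then have "h (t *\<^sub>R z) = (- t) * h (- z)" "grad_norm h (t *\<^sub>R z) = grad_norm h (- z)"
        using pos_homogeneousD[OF h, of "- t" "- z"] grad_norm_scale[OF h, of "- t" "- z"] by simp_all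
      moreover have "- t * h (- z) = t \<longleftrightarrow> h (- z) = - 1"
      proof -
        have "- t * h (- z) = t \<longleftrightarrow> t * (h (- z) + 1) = 0" by (auto simp: algebra_simps)
        then show ?thesis using 2 by (simp add: add_eq_0_iff2)
      qed
      ultimately show ?thesis using 2
        by (simp add: ray_integrand_simp[OF h])
    qed (simp add: ray_integrand_simp[OF h])
  qed
  also have "\<dots> \<in> borel_measurable borel" by measurable
  finally show ?thesis .
qed

section \<open>Expectations over the completion and differentiation under them\<close>

lemma borel_measurable_completion_AE:
  fixes Y Y' :: "'a \<Rightarrow> real"
  assumes Y': "Y' \<in> borel_measurable (completion M)" and eq: "AE \<omega> in M. Y \<omega> = Y' \<omega>"
  shows "Y \<in> borel_measurable (completion M)"
proof (rule measurableI)
  fix A :: "real set" assume A: "A \<in> sets borel"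
  have "AE \<omega> in completion M. Y \<omega> = Y' \<omega>" using eq by (rule AE_completion)
  then have "AE \<omega> in completion M. \<omega> \<in> Y' -` A \<inter> space (completion M) \<longleftrightarrow> \<omega> \<in> Y -` A \<inter> space (completion M)"
    by eventually_elim auto
  then show "Y -` A \<inter> space (completion M) \<in> sets (completion M)"
    by (rule completion.in_sets_AE[OF _ measurable_sets[OF Y' A]]) auto
qed simp

lemma has_expectation_AE:
  assumes Y': "integrable M Y'" and eq: "AE \<omega> in M. Y \<omega> = Y' \<omega>"
  shows "has_expectation M Y (LINT \<omega>|M. Y' \<omega>)"
proof -
  have m: "Y' \<in> borel_measurable M" using Y' by auto
  then have mc: "Y' \<in> borel_measurable (completion M)" by (rule measurable_completion)
  have my: "Y \<in> borel_measurable (completion M)" using mc eq by (rule borel_measurable_completion_AE)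
  have eq': "AE \<omega> in completion M. Y \<omega> = Y' \<omega>" using eq by (rule AE_completion)
  have "integrable (completion M) Y'" using Y' m by (simp add: integrable_completion)
  then have "integrable (completion M) Y"
    using integrable_cong_AE[OF my mc eq'] by simp
  moreover have "(LINT \<omega>|completion M. Y \<omega>) = (LINT \<omega>|M. Y' \<omega>)"
    using integral_cong_AE[OF my mc eq'] integral_completion[OF m] by simp
  ultimately show ?thesis by (simp add: has_expectation_def)
qed

text \<open>The null event of the Lipschitz bound may change with the increment, so the limit is
  taken along sequences, where only countably many null events occur.\<close>

lemma derivative_expectation:
  fixes \<alpha> :: "real \<Rightarrow> real"
  assumes W: "\<And>u. \<bar>u - \<xi>\<bar> < r \<Longrightarrow> has_expectation M (\<lambda>\<omega>. W \<omega> u) (\<alpha> u)" and r: "0 < r"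
    and lip: "stochastic_lipschitz_at M W \<xi>"
    and der: "AE \<omega> in M. (W \<omega> has_real_derivative \<nu> \<omega>) (at \<xi>)"
  shows "\<exists>\<alpha>'. (\<alpha> has_real_derivative \<alpha>') (at \<xi>) \<and> has_expectation M \<nu> \<alpha>'"
proof -
  let ?C = "completion M"
  define q where "q d \<omega> = (W \<omega> (\<xi> + d) - W \<omega> \<xi>) / d" for d \<omega>
  from lip obtain K where K: "integrable M K" and ev: "\<forall>\<^sub>F d in at 0. AE \<omega> in M. \<bar>W \<omega> (\<xi> + d) - W \<omega> \<xi>\<bar> \<le> K \<omega> * \<bar>d\<bar>"
    unfolding stochastic_lipschitz_at_def by blast
  have KC: "integrable ?C K" using K by (simp add: integrable_completion)
  from ev obtain \<delta>' where \<delta>': "\<delta>' > 0" "\<And>d. d \<noteq> 0 \<Longrightarrow> \<bar>d\<bar> < \<delta>' \<Longrightarrow> AE \<omega> in M. \<bar>W \<omega> (\<xi> + d) - W \<omega> \<xi>\<bar> \<le> K \<omega> * \<bar>d\<bar>"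
    unfolding eventually_at by (auto simp: dist_real_def)
  define \<delta> where "\<delta> = min r \<delta>'"
  have \<delta>: "\<delta> > 0" using r \<delta>' by (simp add: \<delta>_def)
  have Wi: "integrable ?C (\<lambda>\<omega>. W \<omega> u)" "(LINT \<omega>|?C. W \<omega> u) = \<alpha> u" if "\<bar>u - \<xi>\<bar> < \<delta>" for u
    using W[of u] that by (auto simp: has_expectation_def \<delta>_def)
  have qi: "integrable ?C (q d)" "(LINT \<omega>|?C. q d \<omega>) = (\<alpha> (\<xi> + d) - \<alpha> \<xi>) / d" if "\<bar>d\<bar> < \<delta>" for d
    using Wi[of "\<xi> + d"] Wi[of \<xi>] that \<delta> by (simp_all add: q_def[abs_def])
  have qb: "AE \<omega> in ?C. norm (q d \<omega>) \<le> K \<omega>" if "d \<noteq> 0" "\<bar>d\<bar> < \<delta>" for d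
  proof -
    have "AE \<omega> in M. norm (q d \<omega>) \<le> K \<omega>"
      using \<delta>'(2)[of d] that by (auto elim!: eventually_mono simp: q_def \<delta>_def divide_le_eq)
    then show ?thesis by (rule AE_completion)
  qed
  have lim: "AE \<omega> in ?C. (\<lambda>n. q (s n) \<omega>) \<longlonglongrightarrow> \<nu> \<omega>" if s: "s \<longlonglongrightarrow> 0" "\<And>n. s n \<noteq> 0" for s
  proof -
    have "AE \<omega> in M. (\<lambda>n. q (s n) \<omega>) \<longlonglongrightarrow> \<nu> \<omega>"
      using der
    proof eventually_elim
      case (elim \<omega>)
      then have "((\<lambda>d. q d \<omega>) \<longlongrightarrow> \<nu> \<omega>) (at 0)" by (simp add: DERIV_def q_def)
      moreover have "filterlim s (at 0) sequentially"
        using s by (auto simp: filterlim_at)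
      ultimately show ?case by (rule filterlim_compose)
    qed
    then show ?thesis by (rule AE_completion)
  qed
  \<comment> \<open>One concrete sequence that stays below \<open>\<delta>\<close>: the limit of its
    difference quotients shows that \<open>\<nu>\<close> is measurable for the completion, before
    any dominated convergence.\<close>
  define s where "s n = \<delta> / 2 * inverse (real (Suc n))" for n
  have s: "s n \<noteq> 0" "\<bar>s n\<bar> < \<delta>" for n
  proof -
    show "s n \<noteq> 0" using \<delta> by (simp add: s_def)
    have "inverse (real (Suc n)) \<le> 1" by (simp add: field_simps)
    then have "s n \<le> \<delta> / 2 * 1" using \<delta> unfolding s_def by (intro mult_left_mono) auto
    moreover have "0 \<le> s n" using \<delta> by (simp add: s_def)
    ultimately show "\<bar>s n\<bar> < \<delta>" using \<delta> by linarith
  qed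
  have s0: "s \<longlonglongrightarrow> 0"
    using tendsto_mult_left[OF LIMSEQ_inverse_real_of_nat, of "\<delta> / 2"] by (simp add: s_def[abs_def])
  have \<nu>m: "\<nu> \<in> borel_measurable ?C"
  proof -
    have "(\<lambda>\<omega>. lim (\<lambda>n. q (s n) \<omega>)) \<in> borel_measurable ?C"
      using qi(1) s by (intro borel_measurable_lim_metric) auto
    moreover have "AE \<omega> in M. \<nu> \<omega> = lim (\<lambda>n. q (s n) \<omega>)"
      using lim[OF s0 s(1)] unfolding AE_completion_iff by eventually_elim (simp add: limI)
    ultimately show ?thesis by (rule borel_measurable_completion_AE)
  qed
  have conv: "integrable ?C \<nu>" "(\<lambda>n. (\<alpha> (\<xi> + s n) - \<alpha> \<xi>) / s n) \<longlonglongrightarrow> (LINT \<omega>|?C. \<nu> \<omega>)"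
    if s: "s \<longlonglongrightarrow> 0" "\<And>n. s n \<noteq> 0" "\<And>n. \<bar>s n\<bar> < \<delta>" for s
  proof -
    have b: "AE \<omega> in ?C. norm (q (s n) \<omega>) \<le> K \<omega>" for n using qb s by blast
    have m: "q (s n) \<in> borel_measurable ?C" for n using qi(1) s by blast
    show "integrable ?C \<nu>"
      by (rule integrable_dominated_convergence[OF \<nu>m m KC lim[OF s(1,2)] b])
    have "(\<lambda>n. LINT \<omega>|?C. q (s n) \<omega>) \<longlonglongrightarrow> (LINT \<omega>|?C. \<nu> \<omega>)"
      by (rule integral_dominated_convergence[OF \<nu>m m KC lim[OF s(1,2)] b])
    then show "(\<lambda>n. (\<alpha> (\<xi> + s n) - \<alpha> \<xi>) / s n) \<longlonglongrightarrow> (LINT \<omega>|?C. \<nu> \<omega>)"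
      using qi(2) s by simp
  qed
  have "(\<alpha> has_real_derivative (LINT \<omega>|?C. \<nu> \<omega>)) (at \<xi>)"
    unfolding DERIV_def tendsto_at_iff_sequentially
  proof (intro allI impI)
    fix s :: "nat \<Rightarrow> real" assume s: "\<forall>i. s i \<in> UNIV - {0}" "s \<longlonglongrightarrow> 0"
    have "\<forall>\<^sub>F n in sequentially. \<bar>s n\<bar> < \<delta>"
      using s(2) \<delta> by (auto simp: tendsto_iff dist_real_def)
    \<comment> \<open>An arbitrary null sequence obeys the bound \<open>\<delta>\<close> only from
      some index on; dropping its first terms does not affect the limit.\<close>
    then obtain N where N: "\<And>n. \<bar>s (n + N)\<bar> < \<delta>" unfolding eventually_sequentially by (metis le_add2)
    have "(\<lambda>n. (\<alpha> (\<xi> + s (n + N)) - \<alpha> \<xi>) / s (n + N)) \<longlonglongrightarrow> (LINT \<omega>|?C. \<nu> \<omega>)"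
      by (rule conv(2)) (use s N in \<open>auto intro: LIMSEQ_ignore_initial_segment\<close>)
    then show "((\<lambda>d. (\<alpha> (\<xi> + d) - \<alpha> \<xi>) / d) \<circ> s) \<longlonglongrightarrow> (LINT \<omega>|?C. \<nu> \<omega>)"
      unfolding o_def by (rule LIMSEQ_offset)
  qed
  moreover have "has_expectation M \<nu> (LINT \<omega>|?C. \<nu> \<omega>)"
    using conv(1)[OF s0 s] by (simp add: has_expectation_def)
  ultimately show ?thesis by blast
qed

text \<open>Differentiability gives continuity on the Borel set \<open>D\<close>; outside
  \<open>D\<close> nothing is known about \<open>h\<close>, hence the cut-off.\<close>

lemma borel_indicator_differentiable:
  fixes h :: "'a::euclidean_space \<Rightarrow> real"
  assumes "D \<in> sets borel" "\<And>x. x \<in> D \<Longrightarrow> h differentiable (at x)"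
  shows "(\<lambda>x. indicat_real D x *\<^sub>R h x) \<in> borel_measurable borel"
  using assms by (intro borel_measurable_continuous_on_indicator differentiable_imp_continuous_on)
    (auto simp: differentiable_on_def intro: differentiable_at_withinI)

section \<open>Cancellation of the gradient norm in the quotients\<close>

locale homogeneous_density =
  fixes f g h :: "real^'m \<Rightarrow> real" and \<Omega> D N0 :: "(real^'m) set" and c0 c1 :: ereal
  assumes f_meas [measurable]: "f \<in> borel_measurable borel"
    and f_pos: "0 \<le> f x"
    and f_finite: "(\<integral>\<^sup>+x. f x \<partial>lborel) < top"
    and f_off: "x \<notin> \<Omega> \<Longrightarrow> f x = 0"
    and \<Omega>_meas [measurable]: "\<Omega> \<in> sets borel"
    and g_meas [measurable]: "g \<in> borel_measurable borel"
    and hom_h: "pos_homogeneous h"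
    and D_meas [measurable]: "D \<in> sets borel"
    and N0: "N0 \<in> null_sets lborel"
    and \<Omega>_sub: "\<Omega> - N0 \<subseteq> D"
    and D_diff: "x \<in> D \<Longrightarrow> h differentiable (at x)"
    and D_cone: "0 < t \<Longrightarrow> t *\<^sub>R x \<in> D \<longleftrightarrow> x \<in> D"
    and h_nz: "AE x in lborel. f x \<noteq> 0 \<longrightarrow> h x \<noteq> 0"
    and range: "x \<in> \<Omega> \<Longrightarrow> c0 \<le> ereal (h x) \<and> ereal (h x) \<le> c1"
begin

text \<open>Borel because \<open>h\<close> is differentiable on \<open>D\<close>, still homogeneous
  because \<open>D\<close> is a cone. This is the function to which the disintegration
  applies.\<close>

definition H :: "real^'m \<Rightarrow> real" where "H x = indicat_real D x *\<^sub>R h x"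

lemma AE_supp_D: "AE x in lborel. f x \<noteq> 0 \<longrightarrow> x \<in> D"
  using AE_not_in[OF N0] by eventually_elim (use f_off \<Omega>_sub in blast)

sublocale ray_disintegration H f
proof
  show "H \<in> borel_measurable borel"
    unfolding H_def[abs_def] by (rule borel_indicator_differentiable[OF D_meas D_diff])
  show "H (t *\<^sub>R x) = t * H x" if "0 < t" for t x
    using that by (simp add: H_def D_cone indicator_def pos_homogeneousD[OF hom_h])
  show "AE x in lborel. f x \<noteq> 0 \<longrightarrow> H x \<noteq> 0"
    using AE_supp_D h_nz by eventually_elim (simp add: H_def)
qed (use f_pos f_finite in auto)

text \<open>The last condition keeps almost every point of the ray outside \<open>N0\<close>; those
  of them that lie in \<open>\<Omega>\<close> are then in \<open>D\<close>, where \<open>H\<close>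
  and \<open>h\<close> agree.\<close>

definition good :: "real^'m \<Rightarrow> bool" where
  "good x \<longleftrightarrow> x \<in> D \<and> h x \<noteq> 0 \<and> (H (- x) = - H x \<longrightarrow> (\<forall>i. partial_deriv h i (- x) = partial_deriv h i x)) \<and>
     0 < den x \<and> den x < top \<and> (AE t in lborel. t \<noteq> 0 \<longrightarrow> t *\<^sub>R Z x \<notin> N0)"

lemma H_good: "good x \<Longrightarrow> H x = h x" "good x \<Longrightarrow> H x \<noteq> 0" "good x \<Longrightarrow> Z x = x /\<^sub>R h x"
  by (auto simp: good_def H_def ray_dir_def)

lemma AE_ray_N0: "AE x in lborel. H x \<noteq> 0 \<longrightarrow> (AE t in lborel. t \<noteq> 0 \<longrightarrow> t *\<^sub>R Z x \<notin> N0)"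
  using AE_ray_notin_null[OF N0]
proof eventually_elim
  case (elim x)
  have [measurable]: "N0 \<in> sets borel" using N0 by auto
  show ?case
  proof
    assume nz: "H x \<noteq> 0"
    have "AE t in lborel. 0 + inverse (H x) * t \<noteq> 0 \<longrightarrow> (0 + inverse (H x) * t) *\<^sub>R x \<notin> N0"
    proof (rule AE_borel_affine[where P="\<lambda>s. s \<noteq> 0 \<longrightarrow> s *\<^sub>R x \<notin> N0"])
      show "inverse (H x) \<noteq> 0" using nz by simp
      show "AE s in lborel. s \<noteq> 0 \<longrightarrow> s *\<^sub>R x \<notin> N0" by (rule elim)
    qed measurable
    then show "AE t in lborel. t \<noteq> 0 \<longrightarrow> t *\<^sub>R Z x \<notin> N0"
      by eventually_elim (use nz in \<open>simp add: ray_dir_def mult.commute\<close>)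
  qed
qed

lemma AE_good: "AE x in lborel. f x \<noteq> 0 \<longrightarrow> good x"
proof -
  define S where "S = {x. x \<in> D \<and> - x \<in> D \<and> H (- x) = - H x}"
  have "AE x in lborel. x \<in> S \<longrightarrow> (\<forall>i. partial_deriv h i (- x) = partial_deriv h i x)"
  proof (rule AE_partial_deriv_antipodal)
    show "S \<in> sets borel" unfolding S_def by measurable
    show "h differentiable (at x) \<and> h differentiable (at (- x)) \<and> h (- x) = - h x" if "x \<in> S" for x
      using that D_diff[of x] D_diff[of "- x"] by (auto simp: S_def H_def)
  qed
  then show ?thesis
    using AE_ray_N0 AE_supp_D h_nz den_finite den_pos
  proof eventually_elim
    case (elim x)
    show ?case
    proof
      assume fx: "f x \<noteq> 0"
      with elim have x: "x \<in> D" "h x \<noteq> 0" by auto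
      then have Hx: "H x \<noteq> 0" by (simp add: H_def)
      have "\<forall>i. partial_deriv h i (- x) = partial_deriv h i x" if "H (- x) = - H x"
      proof -
        \<comment> \<open>Outside \<open>D\<close> the cut function is 0, which cannot equal the
          nonzero \<open>- H x\<close>.\<close>
        have "- x \<in> D" using that Hx by (cases "- x \<in> D") (auto simp: H_def)
        then show ?thesis using elim(1) x that by (simp add: S_def)
      qed
      with x Hx fx elim show "good x" by (auto simp: good_def zero_less_iff_neq_zero)
    qed
  qed
qed

text \<open>The point on the ray is \<open>s *\<^sub>R x\<close> with \<open>s = t / h x\<close>.
  For \<open>s > 0\<close> the gradient norm is the same by homogeneity. For \<open>s < 0\<close>
  the equation \<open>h (t *\<^sub>R Z x) = t\<close> forces \<open>h (- x) = - h x\<close>, and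
  \<open>good\<close> supplies equal gradients at \<open>x\<close> and \<open>- x\<close>. Off
  \<open>\<Omega>\<close> the weight \<open>L\<close> may be positive, but \<open>\<phi>\<close>
  vanishes.\<close>

lemma ray_integrand_good:
  assumes x: "good x" and \<phi>: "\<And>y. y \<notin> \<Omega> \<Longrightarrow> \<phi> y = 0" and t: "t \<noteq> 0" "t *\<^sub>R Z x \<notin> N0"
  shows "ray_integrand \<Omega> h \<phi> (x /\<^sub>R h x) t = L x t * \<phi> (t *\<^sub>R Z x) / grad_norm h x"
proof (cases "t *\<^sub>R Z x \<in> \<Omega>")
  case False
  then show ?thesis using \<phi> H_good(3)[OF x] by (simp add: ray_integrand_simp[OF hom_h])
next
  case True
  with t \<Omega>_sub have tD: "t *\<^sub>R Z x \<in> D" by blast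
  then have Ht: "H (t *\<^sub>R Z x) = h (t *\<^sub>R Z x)" by (simp add: H_def)
  have "grad_norm h (t *\<^sub>R Z x) = grad_norm h x" if ht: "h (t *\<^sub>R Z x) = t"
  proof -
    define s where "s = t / h x"
    have sx: "t *\<^sub>R Z x = s *\<^sub>R x" using H_good[OF x] by (simp add: ray_dir_def s_def divide_inverse)
    have "s \<noteq> 0" using t H_good[OF x] by (simp add: s_def)
    then consider "0 < s" | "s < 0" by linarith
    then show ?thesis
    proof cases
      case 1
      then show ?thesis unfolding sx by (rule grad_norm_scale[OF hom_h])
    next
      case 2
      have neg: "s *\<^sub>R x = (- s) *\<^sub>R (- x)" by simp
      have mx: "- x \<in> D" using tD 2 D_cone[of "- s" "- x"] unfolding sx neg by simp
      have "(- s) * h (- x) = t"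
        using ht 2 pos_homogeneousD[OF hom_h, of "- s" "- x"] unfolding sx neg by simp
      moreover have "t = s * h x" using H_good[OF x] by (simp add: s_def)
      ultimately have "s * (h (- x) + h x) = 0" by (simp add: distrib_left)
      then have "h (- x) = - h x" using 2 by (simp add: add_eq_0_iff2)
      with mx have "H (- x) = - H x" using x by (simp add: H_def good_def)
      then have "grad_norm h (- x) = grad_norm h x"
        using x by (simp add: good_def grad_norm_def)
      then show ?thesis
        unfolding sx neg using 2 by (simp add: grad_norm_scale[OF hom_h] del: scaleR_minus_left scaleR_minus_right)
    qed
  qed
  then show ?thesis
    using True t H_good[OF x] Ht
    by (auto simp: ray_integrand_simp[OF hom_h] ray_weight_def)
qed

lemma ray_integrand_range:
  assumes "ray_integrand \<Omega> h \<phi> z t \<noteq> 0"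
  shows "c0 \<le> ereal t \<and> ereal t \<le> c1"
  using assms range[of "t *\<^sub>R z"] by (auto simp: ray_integrand_simp[OF hom_h] split: if_splits)

lemma AE_ray_integrand_good:
  assumes x: "good x" and \<phi>: "\<And>y. y \<notin> \<Omega> \<Longrightarrow> \<phi> y = 0"
  shows "AE t in lborel. ray_integrand \<Omega> h \<phi> (x /\<^sub>R h x) t = L x t * \<phi> (t *\<^sub>R Z x) / grad_norm h x"
proof -
  have "AE t in lborel. t \<noteq> 0 \<longrightarrow> t *\<^sub>R Z x \<notin> N0" using x by (simp add: good_def)
  then show ?thesis using AE_nonzero
    by eventually_elim (use ray_integrand_good[OF x \<phi>] in auto)
qed

lemma grad_norm_good: "good x \<Longrightarrow> 0 < grad_norm h x"
  unfolding grad_norm_def by (rule gradient_norm_pos[OF hom_h]) (auto simp: good_def D_diff)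

lemma den_good: "good x \<Longrightarrow> 0 < enn2real (den x)"
  by (auto simp: good_def enn2real_positive_iff)

abbreviation "ray_den x \<equiv> (LBINT t=c0..c1. ray_integrand \<Omega> h f (x /\<^sub>R h x) t)"

lemma ray_den_good:
  assumes x: "good x" and c: "c0 < c1"
  shows "ray_den x = enn2real (den x) / grad_norm h x"
proof -
  have m [measurable]: "ray_integrand \<Omega> h f (x /\<^sub>R h x) \<in> borel_measurable borel"
    by (rule borel_ray_integrand[OF hom_h]) measurable
  have "ray_den x = (LINT t|lborel. ray_integrand \<Omega> h f (x /\<^sub>R h x) t)"
    using c ray_integrand_range by (intro interval_integral_whole m)
  also have "\<dots> = (LINT t|lborel. L x t * f (t *\<^sub>R Z x) / grad_norm h x)"
    using AE_ray_integrand_good[OF x, of f] f_off by (intro integral_cong_AE) auto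
  also have "\<dots> = (LINT t|lborel. L x t * f (t *\<^sub>R Z x)) / grad_norm h x"
    by simp
  also have "(LINT t|lborel. L x t * f (t *\<^sub>R Z x)) = enn2real (den x)"
    unfolding den_def by (subst integral_eq_nn_integral) (auto simp: f_pos ennreal_mult)
  finally show ?thesis .
qed

text \<open>A version of \<open>nubar\<close> with the gradient norm cancelled. It is jointly Borel
  in \<open>x\<close> and \<open>t\<close>, which is what Fubini requires.\<close>

definition weighted_dens :: "real^'m \<Rightarrow> real \<Rightarrow> real" where
  "weighted_dens x t = cond_dens x t * g (t *\<^sub>R Z x)"

lemma borel_weighted_dens [measurable (raw)]:
  assumes [measurable]: "p \<in> borel_measurable M" "q \<in> borel_measurable M"
  shows "(\<lambda>x. weighted_dens (p x) (q x)) \<in> borel_measurable M"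
  unfolding weighted_dens_def by measurable

lemma weighted_dens_eq:
  assumes x: "good x" and c: "c0 < c1"
  shows "weighted_dens x t = (L x t * (g (t *\<^sub>R Z x) * f (t *\<^sub>R Z x)) / grad_norm h x) / ray_den x"
  using den_good[OF x] grad_norm_good[OF x] by (simp add: ray_den_good[OF x c] weighted_dens_def cond_dens_def)

lemma nubar_good:
  assumes x: "good x" and c: "c0 < c1" and t: "t \<noteq> 0" "t *\<^sub>R Z x \<notin> N0"
  shows "nubar \<Omega> f g h c0 c1 (x /\<^sub>R h x) t = weighted_dens x t"
  unfolding nubar_def weighted_dens_eq[OF x c]
  using ray_integrand_good[OF x _ t, of "\<lambda>y. g y * f y"] f_off by simp

lemma wbar_upto:
  assumes c: "c0 < ereal \<xi>"
  shows "wbar \<Omega> f g h c0 c1 (x /\<^sub>R h x) \<xi> =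
    (LINT t:{..\<xi>}|lborel. ray_integrand \<Omega> h (\<lambda>y. g y * f y) (x /\<^sub>R h x) t) / ray_den x"
proof -
  have m: "ray_integrand \<Omega> h (\<lambda>y. g y * f y) (x /\<^sub>R h x) \<in> borel_measurable borel"
    by (rule borel_ray_integrand[OF hom_h]) measurable
  show ?thesis
    unfolding wbar_def using interval_integral_upto[OF m c] ray_integrand_range by simp
qed

lemma wbar_good:
  assumes x: "good x" and c: "c0 < ereal \<xi>" "ereal \<xi> < c1"
  shows "wbar \<Omega> f g h c0 c1 (x /\<^sub>R h x) \<xi> = (LINT t|lborel. weighted_dens x t * indicat_real {..\<xi>} t)"
proof -
  have c01: "c0 < c1" using c by (rule less_trans)
  have m [measurable]: "ray_integrand \<Omega> h (\<lambda>y. g y * f y) (x /\<^sub>R h x) \<in> borel_measurable borel"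
    by (rule borel_ray_integrand[OF hom_h]) measurable
  have "wbar \<Omega> f g h c0 c1 (x /\<^sub>R h x) \<xi> =
      (LINT t|lborel. indicat_real {..\<xi>} t *\<^sub>R ray_integrand \<Omega> h (\<lambda>y. g y * f y) (x /\<^sub>R h x) t / ray_den x)"
    using wbar_upto[OF c(1)] by (simp add: set_lebesgue_integral_def)
  also have "\<dots> = (LINT t|lborel. weighted_dens x t * indicat_real {..\<xi>} t)"
  proof (rule integral_cong_AE)
    show "AE t in lborel. indicat_real {..\<xi>} t *\<^sub>R ray_integrand \<Omega> h (\<lambda>y. g y * f y) (x /\<^sub>R h x) t / ray_den x
        = weighted_dens x t * indicat_real {..\<xi>} t"
      using AE_ray_integrand_good[OF x, of "\<lambda>y. g y * f y"] f_off weighted_dens_eq[OF x c01]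
      by (auto elim!: eventually_mono)
  qed measurable
  finally show ?thesis .
qed

section \<open>Fubini for the joint density and differentiation in the threshold\<close>

definition cumulative :: "real \<Rightarrow> real" where
  "cumulative \<xi> = (LINT x|lborel. f x * (g x * indicat_real {..\<xi>} (H x)))"

context
  fixes \<xi> :: real
  assumes int: "integrable lborel (\<lambda>x. f x * (g x * indicat_real {..\<xi>} (H x)))"
begin

text \<open>The weight in \<open>cond_dens\<close> vanishes unless \<open>H\<close> takes the value
  \<open>t\<close> at the point, so the event on \<open>H\<close> becomes a cut-off of
  \<open>t\<close>.\<close>

lemma joint_eq:
  "f x * (cond_dens x t * (g (t *\<^sub>R Z x) * indicat_real {..\<xi>} (H (t *\<^sub>R Z x)))) = f x * (weighted_dens x t * indicat_real {..\<xi>} t)"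
proof (cases "cond_dens x t = 0")
  case False
  then have "H (t *\<^sub>R Z x) = t" by (auto simp: cond_dens_def ray_weight_def split: if_splits)
  then show ?thesis by (simp add: weighted_dens_def)
qed (simp add: weighted_dens_def)

lemma joint_integrable: "integrable (lborel \<Otimes>\<^sub>M lborel) (\<lambda>(x, t). f x * (weighted_dens x t * indicat_real {..\<xi>} t))"
  and joint_integral: "(LINT p|(lborel \<Otimes>\<^sub>M lborel). (\<lambda>(x, t). f x * (weighted_dens x t * indicat_real {..\<xi>} t)) p) = cumulative \<xi>"
  using disintegration[of "\<lambda>x. g x * indicat_real {..\<xi>} (H x)"] int
  unfolding joint_eq cumulative_def by auto

lemma wbar_integrable: "integrable lborel (\<lambda>x. f x * (LINT t|lborel. weighted_dens x t * indicat_real {..\<xi>} t))"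
  and wbar_integral: "(LINT x|lborel. f x * (LINT t|lborel. weighted_dens x t * indicat_real {..\<xi>} t)) = cumulative \<xi>"
  using lborel_pair.integrable_fst[OF joint_integrable] lborel_pair.integral_fst[OF joint_integrable] joint_integral
  by simp_all

lemma AE_weighted_dens_integrable: "AE x in lborel. f x \<noteq> 0 \<longrightarrow> integrable lborel (\<lambda>t. weighted_dens x t * indicat_real {..\<xi>} t)"
  using lborel_pair.AE_integrable_fst[OF joint_integrable] by eventually_elim auto

end

definition mean_dens :: "real \<Rightarrow> real" where
  "mean_dens t = (LINT x|lborel. f x * weighted_dens x t)"

text \<open>Integrability of \<open>g\<close> is only given below a threshold less than
  \<open>c1\<close>. The cut-off at a fixed \<open>r\<close> yields one integrable integrand that
  serves all \<open>u \<le> r\<close>.\<close>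

lemma cumulative_eq_integral:
  assumes r: "integrable lborel (\<lambda>x. f x * (g x * indicat_real {..r} (H x)))"
    and u: "integrable lborel (\<lambda>x. f x * (g x * indicat_real {..u} (H x)))" "u \<le> r"
  shows "cumulative u = (LINT t:{..u}|lborel. (LINT x|lborel. f x * (weighted_dens x t * indicat_real {..r} t)))"
proof -
  have "cumulative u = (LINT t|lborel. LINT x|lborel. f x * (weighted_dens x t * indicat_real {..u} t))"
    using lborel_pair.integral_snd[OF joint_integrable[OF u(1)]] joint_integral[OF u(1)] by simp
  also have "\<dots> = (LINT t:{..u}|lborel. (LINT x|lborel. f x * (weighted_dens x t * indicat_real {..r} t)))"
    unfolding set_lebesgue_integral_def
    using u(2) by (intro Bochner_Integration.integral_cong) (auto split: split_indicator)
  finally show ?thesis .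
qed

lemma AE_derivative_below:
  assumes int: "\<And>\<xi>. c0 < ereal \<xi> \<Longrightarrow> ereal \<xi> < c1 \<Longrightarrow> integrable lborel (\<lambda>x. f x * (g x * indicat_real {..\<xi>} (H x)))"
    and r: "ereal r < c1"
  shows "AE \<xi> in lborel. c0 < ereal \<xi> \<and> \<xi> < r \<longrightarrow>
    (cumulative has_real_derivative mean_dens \<xi>) (at \<xi>) \<and> integrable lborel (\<lambda>x. f x * weighted_dens x \<xi>)"
proof (cases "c0 < ereal r")
  case True
  note ir = int[OF True r]
  define e where "e t = (LINT x|lborel. f x * (weighted_dens x t * indicat_real {..r} t))" for t
  have "integrable lborel e"
    unfolding e_def[abs_def] using lborel_pair.integrable_snd[OF joint_integrable[OF ir]] by simp
  from lebesgue_differentiation_real[OF this] lborel_pair.AE_integrable_snd[OF joint_integrable[OF ir]]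
  show ?thesis
  proof eventually_elim
    case (elim \<xi>)
    show ?case
    proof
      assume \<xi>: "c0 < ereal \<xi> \<and> \<xi> < r"
      obtain l where l: "c0 < ereal l" "l < \<xi>"
        using \<xi> ereal_dense2[of c0 "ereal \<xi>"] by auto
      have ev: "\<forall>\<^sub>F u in nhds \<xi>. cumulative u = (LINT t:{..u}|lborel. e t)"
      proof (rule eventually_mono[OF eventually_nhds_in_open[of "{l<..<r}"]])
        fix u assume u: "u \<in> {l<..<r}"
        then have "c0 < ereal u" "ereal u < c1"
          using l r by (auto intro: less_trans[of c0 "ereal l"] less_trans[of _ "ereal r" c1])
        from cumulative_eq_integral[OF ir int[OF this]] u show "cumulative u = (LINT t:{..u}|lborel. e t)"
          by (simp add: e_def)
      qed (use l \<xi> in auto)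
      have "e \<xi> = mean_dens \<xi>" using \<xi> by (simp add: e_def mean_dens_def)
      then have "(cumulative has_real_derivative mean_dens \<xi>) (at \<xi>)"
        using elim(1) DERIV_cong_ev[OF refl ev refl] by simp
      moreover have "integrable lborel (\<lambda>x. f x * weighted_dens x \<xi>)" using elim(2) \<xi> by simp
      ultimately show "(cumulative has_real_derivative mean_dens \<xi>) (at \<xi>) \<and> integrable lborel (\<lambda>x. f x * weighted_dens x \<xi>)" ..
    qed
  qed
next
  case False
  then have "\<not> (c0 < ereal \<xi> \<and> \<xi> < r)" for \<xi>
    by (metis ereal_less_eq(3) less_imp_le less_le_trans)
  then show ?thesis by auto
qed

text \<open>Rational \<open>r\<close> below \<open>c1\<close> exhaust the interval, so the
  exceptional sets of the truncated statements stay null in total.\<close>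

lemma AE_derivative:
  assumes int: "\<And>\<xi>. c0 < ereal \<xi> \<Longrightarrow> ereal \<xi> < c1 \<Longrightarrow> integrable lborel (\<lambda>x. f x * (g x * indicat_real {..\<xi>} (H x)))"
  shows "AE \<xi> in lborel. c0 < ereal \<xi> \<and> ereal \<xi> < c1 \<longrightarrow>
    (cumulative has_real_derivative mean_dens \<xi>) (at \<xi>) \<and> integrable lborel (\<lambda>x. f x * weighted_dens x \<xi>)"
proof -
  have "AE \<xi> in lborel. \<forall>r\<in>\<rat>. ereal r < c1 \<longrightarrow> c0 < ereal \<xi> \<and> \<xi> < r \<longrightarrow>
      (cumulative has_real_derivative mean_dens \<xi>) (at \<xi>) \<and> integrable lborel (\<lambda>x. f x * weighted_dens x \<xi>)"
  proof (intro AE_ball_countable' countable_rat)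
    fix r :: real
    show "AE \<xi> in lborel. ereal r < c1 \<longrightarrow> c0 < ereal \<xi> \<and> \<xi> < r \<longrightarrow>
      (cumulative has_real_derivative mean_dens \<xi>) (at \<xi>) \<and> integrable lborel (\<lambda>x. f x * weighted_dens x \<xi>)"
      using AE_derivative_below[OF int, of r] by (cases "ereal r < c1") auto
  qed
  then show ?thesis
  proof eventually_elim
    case (elim \<xi>)
    show ?case
    proof
      assume \<xi>: "c0 < ereal \<xi> \<and> ereal \<xi> < c1"
      then obtain b where b: "\<xi> < b" "ereal b < c1" using ereal_dense2[of "ereal \<xi>" c1] by auto
      obtain r where r: "r \<in> \<rat>" "\<xi> < r" "r < b" using Rats_dense_in_real[OF b(1)] by blast
      with b(2) have "ereal r < c1" by (meson ereal_less_le less_ereal.simps(1) less_imp_le less_le_trans less_trans)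
      with elim r \<xi> show "(cumulative has_real_derivative mean_dens \<xi>) (at \<xi>) \<and> integrable lborel (\<lambda>x. f x * weighted_dens x \<xi>)" by blast
    qed
  qed
qed

text \<open>For a good \<open>x\<close> the bad values of \<open>t\<close> are null, but the formula
  at a fixed threshold needs the bad \<open>x\<close> to be null. Fubini turns one into the other
  for almost every \<open>t\<close> only; \<open>N0\<close> might contain a whole level set.\<close>

lemma AE_nubar:
  assumes c: "c0 < c1"
  shows "AE t in lborel. AE x in lborel. f x \<noteq> 0 \<longrightarrow> nubar \<Omega> f g h c0 c1 (x /\<^sub>R h x) t = weighted_dens x t"
proof -
  have [measurable]: "N0 \<in> sets borel" using N0 by auto
  have "AE x in lborel. AE t in lborel. H x \<noteq> 0 \<longrightarrow> t \<noteq> 0 \<longrightarrow> t *\<^sub>R Z x \<notin> N0"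
    using AE_ray_N0 by eventually_elim auto
  then have "AE t in lborel. AE x in lborel. H x \<noteq> 0 \<longrightarrow> t \<noteq> 0 \<longrightarrow> t *\<^sub>R Z x \<notin> N0"
    by (rule lborel_AE_commute[THEN iffD1, rotated]) measurable
  then show ?thesis using AE_nonzero
  proof eventually_elim
    case (elim t)
    from elim(1) AE_good show ?case
    proof eventually_elim
      case (elim x)
      then show ?case using nubar_good[OF _ c \<open>t \<noteq> 0\<close>, of x] H_good(2)[of x] \<open>t \<noteq> 0\<close> by blast
    qed
  qed
qed

text \<open>Argues with \<open>ray_integrand\<close> itself and not with
  \<open>weighted_dens\<close>, which agrees with the quotient only almost everywhere: continuity
  and the value at the single point \<xi> are what counts, and that value is the numerator of
  \<open>nubar\<close>.\<close>

lemma DERIV_wbar: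
  assumes x: "good x" and c: "c0 < ereal \<xi>" "\<xi> < r" "ereal r < c1"
    and int: "integrable lborel (\<lambda>t. weighted_dens x t * indicat_real {..r} t)"
    and cont: "isCont (ray_integrand \<Omega> h (\<lambda>y. g y * f y) (x /\<^sub>R h x)) \<xi>"
  shows "(wbar \<Omega> f g h c0 c1 (x /\<^sub>R h x) has_real_derivative nubar \<Omega> f g h c0 c1 (x /\<^sub>R h x) \<xi>) (at \<xi>)"
proof -
  let ?I = "ray_integrand \<Omega> h (\<lambda>y. g y * f y) (x /\<^sub>R h x)"
  have c01: "c0 < c1" using c by (meson less_ereal.simps(1) less_trans)
  have m [measurable]: "?I \<in> borel_measurable borel"
    by (rule borel_ray_integrand[OF hom_h]) measurable
  have rd: "ray_den x \<noteq> 0" using ray_den_good[OF x c01] den_good[OF x] grad_norm_good[OF x] by simp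
  have "integrable lborel (\<lambda>t. indicat_real {..r} t *\<^sub>R ?I t) \<longleftrightarrow> integrable lborel (\<lambda>t. ray_den x * (weighted_dens x t * indicat_real {..r} t))"
  proof (rule integrable_cong_AE)
    show "AE t in lborel. indicat_real {..r} t *\<^sub>R ?I t = ray_den x * (weighted_dens x t * indicat_real {..r} t)"
      using AE_ray_integrand_good[OF x, of "\<lambda>y. g y * f y"] f_off weighted_dens_eq[OF x c01] rd
      by (auto elim!: eventually_mono)
  qed measurable
  then have "set_integrable lborel {..r} ?I"
    unfolding set_integrable_def using int by simp
  from DERIV_integral_isCont[OF this c(2) cont]
  have d: "((\<lambda>u. (LINT t:{..u}|lborel. ?I t) / ray_den x) has_real_derivative ?I \<xi> / ray_den x) (at \<xi>)"
    by (rule DERIV_cdivide)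
  obtain l where l: "c0 < ereal l" "l < \<xi>"
    using c ereal_dense2[of c0 "ereal \<xi>"] by auto
  have "\<forall>\<^sub>F u in nhds \<xi>. wbar \<Omega> f g h c0 c1 (x /\<^sub>R h x) u = (LINT t:{..u}|lborel. ?I t) / ray_den x"
  proof (rule eventually_mono[OF eventually_nhds_in_open[of "{l<..}"]])
    fix u assume "u \<in> {l<..}"
    then have "c0 < ereal u" using l by (auto intro: less_trans[of c0 "ereal l"])
    then show "wbar \<Omega> f g h c0 c1 (x /\<^sub>R h x) u = (LINT t:{..u}|lborel. ?I t) / ray_den x"
      by (rule wbar_upto)
  qed (use l in auto)
  from DERIV_cong_ev[OF refl this refl] d show ?thesis
    by (simp add: nubar_def)
qed

end

section \<open>Transfer to the random vector\<close>

lemma AE_distributedI: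
  assumes X: "distributed M lborel X (\<lambda>x. ennreal (f x))" and P: "AE x in lborel. f x \<noteq> 0 \<longrightarrow> P x"
  shows "AE \<omega> in M. P (X \<omega>)"
proof -
  have "AE x in density lborel f. P x"
    using P distributed_borel_measurable[OF X] by (subst AE_density) (auto elim!: eventually_mono)
  then have "AE x in distr M lborel X. P x"
    unfolding distributed_distr_eq_density[OF X] .
  then show ?thesis
    using distributed_measurable[OF X] by (rule AE_distrD[rotated])
qed

context homogeneous_density
begin

lemma has_expectation_distributed:
  assumes X: "distributed M lborel X (\<lambda>x. ennreal (f x))"
    and [measurable]: "y \<in> borel_measurable borel" and int: "integrable lborel (\<lambda>x. f x * y x)"
    and eq: "AE x in lborel. f x \<noteq> 0 \<longrightarrow> Y x = y x"
  shows "has_expectation M (\<lambda>\<omega>. Y (X \<omega>)) (LINT x|lborel. f x * y x)"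
proof -
  have "integrable M (\<lambda>\<omega>. y (X \<omega>))"
    using distributed_integrable[OF X, of y] int f_pos by simp
  moreover have "AE \<omega> in M. Y (X \<omega>) = y (X \<omega>)"
    using eq by (intro AE_distributedI[OF X]) auto
  moreover have "(LINT x|lborel. f x * y x) = (LINT \<omega>|M. y (X \<omega>))"
    using distributed_integral[OF X, of y] f_pos by simp
  ultimately show ?thesis using has_expectation_AE by metis
qed

end

theorem proposition2:
  fixes M :: "'a measure"
    and X :: "'a \<Rightarrow> real^'m"
    and f g h :: "real^'m \<Rightarrow> real"
    and \<Omega> :: "(real^'m) set"
    and c0 c1 :: ereal
  assumes "prob_space M"
    and "distributed M lborel X (\<lambda>x. ennreal (f x))"
    and "\<And>x. 0 \<le> f x"
    and "\<Omega> \<in> sets borel"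
    and "\<And>x. x \<notin> \<Omega> \<Longrightarrow> f x = 0"
    and "g \<in> borel_measurable borel"
    and "continuous_on \<Omega> h"
    and "continuously_differentiable_ae_on \<Omega> h"
    and "pos_homogeneous h"
    and "\<And>x. x \<in> \<Omega> \<Longrightarrow> c0 \<le> ereal (h x) \<and> ereal (h x) \<le> c1"
    and "AE \<omega> in M. h (X \<omega>) \<noteq> 0"
    and "\<And>\<xi>. c0 < ereal \<xi> \<Longrightarrow> ereal \<xi> < c1 \<Longrightarrow>
           integrable M (\<lambda>\<omega>. g (X \<omega>) * indicat_real {..\<xi>} (h (X \<omega>)))"
  shows
    "(\<forall>\<xi>. c0 < ereal \<xi> \<and> ereal \<xi> < c1 \<longrightarrow>
        has_expectation M (\<lambda>\<omega>. wbar \<Omega> f g h c0 c1 (X \<omega> /\<^sub>R h (X \<omega>)) \<xi>) (alpha M X g h \<xi>)) \<and>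
     (\<forall>\<xi>. c0 < ereal \<xi> \<and> ereal \<xi> < c1 \<longrightarrow>
        stochastic_lipschitz_at M (\<lambda>\<omega>. wbar \<Omega> f g h c0 c1 (X \<omega> /\<^sub>R h (X \<omega>))) \<xi> \<longrightarrow>
        (AE \<omega> in M. isCont (ray_integrand \<Omega> h (\<lambda>x. g x * f x) (X \<omega> /\<^sub>R h (X \<omega>))) \<xi>) \<longrightarrow>
        (\<exists>\<alpha>'. (alpha M X g h has_real_derivative \<alpha>') (at \<xi>) \<and>
              has_expectation M (\<lambda>\<omega>. nubar \<Omega> f g h c0 c1 (X \<omega> /\<^sub>R h (X \<omega>)) \<xi>) \<alpha>')) \<and>
     (AE \<xi> in lborel. c0 < ereal \<xi> \<and> ereal \<xi> < c1 \<longrightarrow>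
        stochastic_lipschitz_at M (\<lambda>\<omega>. wbar \<Omega> f g h c0 c1 (X \<omega> /\<^sub>R h (X \<omega>))) \<xi> \<longrightarrow>
        (\<exists>\<alpha>'. (alpha M X g h has_real_derivative \<alpha>') (at \<xi>) \<and>
              has_expectation M (\<lambda>\<omega>. nubar \<Omega> f g h c0 c1 (X \<omega> /\<^sub>R h (X \<omega>)) \<xi>) \<alpha>'))"
proof -
  note X = assms(2) and f_pos = assms(3) and f_off = assms(5) and hom = assms(9) and int = assms(12)
  have [measurable]: "X \<in> measurable M borel" using distributed_measurable[OF X] by simp
  have [measurable]: "\<Omega> \<in> sets borel" "g \<in> borel_measurable borel" using assms by auto
  have f_meas [measurable]: "f \<in> borel_measurable borel"
  proof -
    have "(\<lambda>x. enn2real (ennreal (f x))) \<in> borel_measurable borel"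
      using distributed_borel_measurable[OF X] by (intro borel_measurable_enn2real) simp
    then show ?thesis using f_pos by simp
  qed
  have f_fin: "(\<integral>\<^sup>+x. f x \<partial>lborel) < top"
  proof -
    have "(\<integral>\<^sup>+x. f x \<partial>lborel) = emeasure (distr M lborel X) UNIV"
      unfolding distributed_distr_eq_density[OF X] by (subst emeasure_density) auto
    also have "\<dots> = 1"
      using prob_space.emeasure_space_1[OF assms(1)] by (subst emeasure_distr) auto
    finally show ?thesis by simp
  qed
  from assms(8) obtain N where N: "N \<in> null_sets lebesgue" "\<And>x. x \<in> \<Omega> - N \<Longrightarrow> h differentiable (at x)"
    unfolding continuously_differentiable_ae_on_def by blast
  obtain D N0 where D: "D \<in> sets borel" "N0 \<in> null_sets lborel" "\<Omega> - N0 \<subseteq> D"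
    "\<And>x. x \<in> D \<Longrightarrow> h differentiable (at x)" "\<And>x t. 0 < t \<Longrightarrow> t *\<^sub>R x \<in> D \<longleftrightarrow> x \<in> D"
    using differentiability_cone[OF assms(4) hom N] by blast
  have supp_D: "AE x in lborel. f x \<noteq> 0 \<longrightarrow> x \<in> D"
    using AE_not_in[OF D(2)] by eventually_elim (use f_off D(3) in blast)
  have h_nz: "AE x in lborel. f x \<noteq> 0 \<longrightarrow> h x \<noteq> 0"
  proof -
    \<comment> \<open>An almost sure statement about \<open>X\<close> passes to Lebesgue measure
      through the law of \<open>X\<close>, which needs a Borel event; \<open>h\<close> has to be
      replaced by its cut-off for that.\<close>
    define hD where "hD x = indicat_real D x *\<^sub>R h x" for x
    have [measurable]: "hD \<in> borel_measurable borel"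
      unfolding hD_def[abs_def] by (rule borel_indicator_differentiable[OF D(1,4)])
    have "AE \<omega> in M. hD (X \<omega>) \<noteq> 0"
      using assms(11) AE_distributedI[OF X supp_D] by eventually_elim (simp add: hD_def)
    then have "AE x in distr M lborel X. hD x \<noteq> 0"
      by (subst AE_distr_iff) auto
    then have "AE x in lborel. f x \<noteq> 0 \<longrightarrow> hD x \<noteq> 0"
      unfolding distributed_distr_eq_density[OF X] using f_pos
      by (subst (asm) AE_density) (auto elim!: eventually_mono simp: order.order_iff_strict)
    then show ?thesis by eventually_elim (auto simp: hD_def)
  qed
  interpret homogeneous_density f g h \<Omega> D N0 c0 c1
    by unfold_locales (use f_pos f_fin f_off hom D h_nz assms(10) in auto)
  have AE_X: "AE \<omega> in M. P (X \<omega>)" if "AE x in lborel. f x \<noteq> 0 \<longrightarrow> P x" for P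
    using X that by (rule AE_distributedI)
  have H_eq: "AE \<omega> in M. H (X \<omega>) = h (X \<omega>)"
    by (rule AE_X) (use AE_good in eventually_elim, use H_good(1) in blast)
  have int_H: "integrable lborel (\<lambda>x. f x * (g x * indicat_real {..\<xi>} (H x)))" and alpha_eq: "alpha M X g h \<xi> = cumulative \<xi>"
    if \<xi>: "c0 < ereal \<xi>" "ereal \<xi> < c1" for \<xi>
  proof -
    let ?u = "\<lambda>x. g x * indicat_real {..\<xi>} (H x)"
    note i = int[OF \<xi>]
    have m: "(\<lambda>\<omega>. ?u (X \<omega>)) \<in> borel_measurable M" by measurable
    have eq: "AE \<omega> in M. g (X \<omega>) * indicat_real {..\<xi>} (h (X \<omega>)) = ?u (X \<omega>)"
      using H_eq by eventually_elim simp
    have "integrable M (\<lambda>\<omega>. ?u (X \<omega>))"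
      using integrable_cong_AE[OF borel_measurable_integrable[OF i] m eq] i by simp
    then show "integrable lborel (\<lambda>x. f x * ?u x)"
      using distributed_integrable[OF X, of ?u] f_pos by simp
    have "alpha M X g h \<xi> = (LINT \<omega>|M. ?u (X \<omega>))"
      unfolding alpha_def by (rule integral_cong_AE[OF borel_measurable_integrable[OF i] m eq])
    then show "alpha M X g h \<xi> = cumulative \<xi>"
      using distributed_integral[OF X, of ?u] f_pos by (simp add: cumulative_def)
  qed
  let ?W = "\<lambda>\<omega>. wbar \<Omega> f g h c0 c1 (X \<omega> /\<^sub>R h (X \<omega>))"
  let ?V = "\<lambda>\<omega>. nubar \<Omega> f g h c0 c1 (X \<omega> /\<^sub>R h (X \<omega>))"
  have claim1: "has_expectation M (\<lambda>\<omega>. ?W \<omega> \<xi>) (alpha M X g h \<xi>)" if \<xi>: "c0 < ereal \<xi>" "ereal \<xi> < c1" for \<xi>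
  proof -
    have "AE x in lborel. f x \<noteq> 0 \<longrightarrow>
        wbar \<Omega> f g h c0 c1 (x /\<^sub>R h x) \<xi> = (LINT t|lborel. weighted_dens x t * indicat_real {..\<xi>} t)"
      using AE_good by eventually_elim (use wbar_good[OF _ \<xi>] in blast)
    then show ?thesis
      using has_expectation_distributed[OF X _ wbar_integrable[OF int_H[OF \<xi>]]]
      unfolding wbar_integral[OF int_H[OF \<xi>]] alpha_eq[OF \<xi>] by measurable
  qed
  have claim2: "\<exists>\<alpha>'. (alpha M X g h has_real_derivative \<alpha>') (at \<xi>) \<and> has_expectation M (\<lambda>\<omega>. ?V \<omega> \<xi>) \<alpha>'"
    if \<xi>: "c0 < ereal \<xi>" "ereal \<xi> < c1" and lip: "stochastic_lipschitz_at M ?W \<xi>"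
      and cont: "AE \<omega> in M. isCont (ray_integrand \<Omega> h (\<lambda>x. g x * f x) (X \<omega> /\<^sub>R h (X \<omega>))) \<xi>" for \<xi>
  proof -
    \<comment> \<open>\<open>l\<close> and \<open>b\<close> keep a neighbourhood of \<xi> inside the
      interval, where the representation of \<open>alpha\<close> is available; \<open>b\<close> is
      moreover the level up to which the ray integral is known to exist.\<close>
    obtain l where l: "c0 < ereal l" "l < \<xi>" using \<xi> ereal_dense2[of c0 "ereal \<xi>"] by auto
    obtain b where b: "\<xi> < b" "ereal b < c1" using \<xi> ereal_dense2[of "ereal \<xi>" c1] by auto
    have between: "c0 < ereal u \<and> ereal u < c1" if "l < u" "u \<le> b" for u
      using that l b by (auto intro: less_trans[of c0 "ereal l"] le_less_trans[of _ "ereal b" c1])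
    show ?thesis
    proof (rule derivative_expectation[OF _ _ lip])
      show "0 < min (\<xi> - l) (b - \<xi>)" using l b by simp
      show "has_expectation M (\<lambda>\<omega>. ?W \<omega> u) (alpha M X g h u)" if "\<bar>u - \<xi>\<bar> < min (\<xi> - l) (b - \<xi>)" for u
        using that between[of u] by (intro claim1) (auto simp: abs_less_iff)
      have "AE x in lborel. f x \<noteq> 0 \<longrightarrow> good x \<and> integrable lborel (\<lambda>t. weighted_dens x t * indicat_real {..b} t)"
        using AE_good AE_weighted_dens_integrable[OF int_H, of b] between[of b] b l by auto
      from AE_X[OF this] cont show "AE \<omega> in M. (?W \<omega> has_real_derivative ?V \<omega> \<xi>) (at \<xi>)"
        by eventually_elim (use DERIV_wbar \<xi>(1) b in blast)
    qed
  qed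
  have claim3: "AE \<xi> in lborel. c0 < ereal \<xi> \<and> ereal \<xi> < c1 \<longrightarrow>
      (\<exists>\<alpha>'. (alpha M X g h has_real_derivative \<alpha>') (at \<xi>) \<and> has_expectation M (\<lambda>\<omega>. ?V \<omega> \<xi>) \<alpha>')"
  proof (cases "c0 < c1")
    case True
    have "AE \<xi> in lborel. c0 < ereal \<xi> \<and> ereal \<xi> < c1 \<longrightarrow>
        (cumulative has_real_derivative mean_dens \<xi>) (at \<xi>) \<and> integrable lborel (\<lambda>x. f x * weighted_dens x \<xi>)"
      by (rule AE_derivative) (rule int_H)
    then show ?thesis using AE_nubar[OF True]
    proof eventually_elim
      case (elim \<xi>)
      show ?case
      proof
        assume \<xi>: "c0 < ereal \<xi> \<and> ereal \<xi> < c1"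
        with elim(1) have d: "(cumulative has_real_derivative mean_dens \<xi>) (at \<xi>)" and i: "integrable lborel (\<lambda>x. f x * weighted_dens x \<xi>)" by auto
        \<comment> \<open>\<open>alpha\<close> and \<open>cumulative\<close> agree only between
          \<open>c0\<close> and \<open>c1\<close>; openness makes this agreement local, so the
          derivative carries over.\<close>
        have "open {u. c0 < ereal u \<and> ereal u < c1}"
          by (intro open_Collect_conj open_Collect_less continuous_intros)
        then have "\<forall>\<^sub>F u in nhds \<xi>. alpha M X g h u = cumulative u"
          by (rule eventually_mono[OF eventually_nhds_in_open]) (use \<xi> alpha_eq in auto)
        from DERIV_cong_ev[OF refl this refl] d have "(alpha M X g h has_real_derivative mean_dens \<xi>) (at \<xi>)" by simp
        moreover have "has_expectation M (\<lambda>\<omega>. ?V \<omega> \<xi>) (mean_dens \<xi>)"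
          unfolding mean_dens_def by (rule has_expectation_distributed[OF X _ i elim(2)]) measurable
        ultimately show "\<exists>\<alpha>'. (alpha M X g h has_real_derivative \<alpha>') (at \<xi>) \<and> has_expectation M (\<lambda>\<omega>. ?V \<omega> \<xi>) \<alpha>'"
          by blast
      qed
    qed
  next
    case False
    then have "\<not> (c0 < ereal \<xi> \<and> ereal \<xi> < c1)" for \<xi> by (meson less_trans)
    then show ?thesis by auto
  qed
  show ?thesis
    using claim1 claim2 claim3 by (auto elim!: eventually_mono)
qed

end
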